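(* $\mathcal{L}_1$ equals the weak*-closed convex hull of $\mathcal{P}$.
   Context: $L^{\infty}(\mathbb{R}_+^{\times})$: real-valued essentially bounded measurable functions on $[1,\infty)$. $\mathcal{L}_1$ is the set of positive linear functionals $\psi$ on $L^{\infty}(\mathbb{R}_+^{\times})$ with $\psi(1)=1$ and $\psi(f)\le\lim_{\theta\to\infty}\limsup_{x\to\infty}\frac{1}{\log\theta}\int_x^{\theta x}f(t)\frac{dt}{t}$ for all $f$. Let $\beta\mathbb{N}_0$ be the Stone–Čech compactification of $\mathbb{N}_0$ (points = ultrafilters), $\tau$ the extension of $n\mapsto n+1$, $\Omega=(\beta\mathbb{N}_0\times[0,1])/\sim$ with $(\tau\eta,0)\sim(\eta,1)$, containing $\mathbb{R}_+=[0,\infty)$ via $(n,t)\mapsto n+t$, $\Omega^*=\Omega\setminus\mathbb{R}_+$; each $\omega=(\eta,t)$ is identified with the ultrafilter $\{A+t:A\in\eta\}$ on $\mathbb{R}_+$, and for an ultrafilter $\mathcal{V}$ on $\mathbb{R}_+$, $e^{\mathcal{V}}=\{e^A:A\in\mathcal{V}\}$. For $f\in L^{\infty}(\mathbb{R}_+^{\times})$ and $\omega\in\Omega^*$, $f^{\times}_\omega=e^\omega\text{-}\lim_rf(r\,\cdot)$ (weak* limit in $L^{\infty}(\mathbb{R}_+^{\times})=L^1(\mathbb{R}_+^{\times})^*$ along $e^\omega$, $r\ge1$). $\mathcal{P}$ is the set of all functionals $\psi^{\mathcal{U}}_\omega(f)=e^{\mathcal{U}}\text{-}\lim_x\frac{1}{\log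 x}\int_1^xf^{\times}_\omega(t)\frac{dt}{t}$, with $\omega\in\Omega^*$ and $\mathcal{U}$ an ultrafilter on $\mathbb{R}_+$ containing no bounded set. *)

theory Defs
  imports "HOL-Analysis.Analysis"
begin

definition ultrafilter :: "'a filter \<Rightarrow> bool" where
  "ultrafilter F \<longleftrightarrow> F \<noteq> bot \<and> (\<forall>P. eventually P F \<or> eventually (\<lambda>x. \<not> P x) F)"

text \<open>L-infinity of the multiplicative half line [1,oo) (with Haar measure dt/t,
  which has the same null sets as Lebesgue measure there). Functions are
  represented by real functions; only their values on [1,oo) matter.\<close>
definition Linf :: "(real \<Rightarrow> real) set" where
  "Linf = {f. set_borel_measurable lborel {1..} f \<and>
              (\<exists>C. AE t in lborel. t \<ge> 1 \<longrightarrow> \<bar>f t\<bar> \<le> C)}"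

definition L1mult :: "(real \<Rightarrow> real) set" where
  "L1mult = {h. set_integrable lborel {1..} (\<lambda>t. h t / t)}"

definition upper_mean :: "(real \<Rightarrow> real) \<Rightarrow> ereal" where
  "upper_mean f = Lim at_top (\<lambda>\<theta>::real. Limsup at_top (\<lambda>x::real.
       ereal (1 / ln \<theta> * (LINT t:{x..\<theta>*x}|lborel. f t / t))))"

text \<open>The set L_1 of positive normalized linear functionals dominated by upper_mean
  (functionals are compared only through their values on Linf).\<close>
definition L1_set :: "((real \<Rightarrow> real) \<Rightarrow> real) set" where
  "L1_set = {\<psi>.
     (\<forall>f\<in>Linf. \<forall>g\<in>Linf. \<forall>a b::real. \<psi> (\<lambda>t. a * f t + b * g t) = a * \<psi> f + b * \<psi> g) \<and>
     (\<forall>f\<in>Linf. (AE t in lborel. t \<ge> 1 \<longrightarrow> f t \<ge> 0) \<longrightarrow> \<psi> f \<ge> 0) \<and>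
     \<psi> (\<lambda>_. 1) = 1 \<and>
     (\<forall>f\<in>Linf. ereal (\<psi> f) \<le> upper_mean f)}"

text \<open>Points of Omega* = Omega minus R_+: pairs (eta, t) with eta a non-principal
  ultrafilter on N_0 and t in [0,1]; omega is identified with the ultrafilter
  {A + t : A in eta} on R_+, so that e^omega is the image of eta under n |-> exp (n + t).\<close>
definition Omega_star_pt :: "nat filter \<Rightarrow> real \<Rightarrow> bool" where
  "Omega_star_pt \<eta> s \<longleftrightarrow> ultrafilter \<eta> \<and> (\<forall>n. \<not> eventually (\<lambda>m. m = n) \<eta>) \<and> s \<in> {0..1}"

definition exp_omega :: "nat filter \<Rightarrow> real \<Rightarrow> real filter" where
  "exp_omega \<eta> s = filtermap (\<lambda>n. exp (real n + s)) \<eta>"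

text \<open>g is the weak* limit (in L^infty = (L^1)^*) of r |-> f(r .) along the filter F.\<close>
definition is_mult_limit :: "(real \<Rightarrow> real) \<Rightarrow> real filter \<Rightarrow> (real \<Rightarrow> real) \<Rightarrow> bool" where
  "is_mult_limit f F g \<longleftrightarrow> g \<in> Linf \<and>
     (\<forall>h\<in>L1mult. ((\<lambda>r. LINT t:{1..}|lborel. f (r * t) * h t / t)
                    \<longlongrightarrow> (LINT t:{1..}|lborel. g t * h t / t)) F)"

definition mult_limit :: "(real \<Rightarrow> real) \<Rightarrow> nat filter \<Rightarrow> real \<Rightarrow> (real \<Rightarrow> real)" where
  "mult_limit f \<eta> s = (SOME g. is_mult_limit f (exp_omega \<eta> s) g)"

definition psi_UO :: "real filter \<Rightarrow> nat filter \<Rightarrow> real \<Rightarrow> (real \<Rightarrow> real) \<Rightarrow> real" where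
  "psi_UO U \<eta> s f = Lim (filtermap exp U)
     (\<lambda>x. 1 / ln x * (LINT t:{1..x}|lborel. mult_limit f \<eta> s t / t))"

text \<open>The set P (functionals compared through their values on Linf).\<close>
definition P_set :: "((real \<Rightarrow> real) \<Rightarrow> real) set" where
  "P_set = {\<psi>. \<exists>U \<eta> s. Omega_star_pt \<eta> s \<and> ultrafilter U \<and>
                 eventually (\<lambda>x. x \<ge> 0) U \<and>
                 (\<forall>A. eventually (\<lambda>x. x \<in> A) U \<longrightarrow> \<not> bounded A) \<and>
                 (\<forall>f\<in>Linf. \<psi> f = psi_UO U \<eta> s f)}"

definition conv_fun :: "((real \<Rightarrow> real) \<Rightarrow> real) set \<Rightarrow> ((real \<Rightarrow> real) \<Rightarrow> real) set" where
  "conv_fun S = {\<psi>. \<exists>(n::nat) c \<phi>. (\<forall>i<n. c i \<ge> (0::real) \<and> \<phi> i \<in> S) \<and> (\<Sum>i<n. c i) = 1 \<and>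
                        \<psi> = (\<lambda>f. \<Sum>i<n. c i * \<phi> i f)}"

definition wstar_closure :: "((real \<Rightarrow> real) \<Rightarrow> real) set \<Rightarrow> ((real \<Rightarrow> real) \<Rightarrow> real) set" where
  "wstar_closure S = {\<psi>. \<forall>F. finite F \<and> F \<subseteq> Linf \<longrightarrow>
       (\<forall>\<epsilon>>0. \<exists>\<phi>\<in>S. \<forall>f\<in>F. \<bar>\<psi> f - \<phi> f\<bar> < \<epsilon>)}"

end

theory Submission
  imports Defs
begin

text \<open>Write \<open>H u\<close> for the integral of \<open>f t / t\<close> over \<open>[1, exp u]\<close>. Then \<open>H\<close> is Lipschitz, \<open>upper_mean f\<close>
  is the largest asymptotic slope of \<open>H\<close> over long intervals, and an element of \<open>P_set\<close> measures
  the mean slope of the limit of \<open>T \<mapsto> H (n + s + T) - H (n + s)\<close> along an ultrafilter. For each \<open>f\<close> one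
  can take this limit along starting points from which \<open>H\<close> grows with nearly the largest slope
  on every scale, so some element of \<open>P_set\<close> attains \<open>upper_mean f\<close> at \<open>f\<close>. Hence no \<open>f\<close> strictly separates
  a point of \<open>L1_set\<close> from \<open>P_set\<close>, which in finitely many coordinates at a time gives weak* density
  of the convex hull.\<close>

text \<open>Both limits behind \<open>P_set\<close> are choices: \<open>mult_limit\<close> is a
  \<open>SOME\<close> and \<open>psi_UO\<close> a \<open>Lim\<close>, so nothing can be said about
  either before the limit is known to exist. For \<open>mult_limit\<close> this is weak* compactness
  of balls of L-infinity, obtained here from Radon-Nikodym applied to the limit functional. From
  then on \<open>mult_limit\<close> is seen only through its integrals over [1, exp T], which are
  limits of increments of H; different choices of \<open>SOME\<close> give the same integrals.

  The starting points for attainment must be steep on every scale at once: the weak* limit then has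
  mean slope at least \<open>upper_slope H\<close> over each [0, T], and every ultrafilter U of
  lengths T gives the required value. One long interval with a large total increase would not do,
  since its initial part may be flat, and for fixed T the limit sees only initial parts.\<close>

section \<open>Ultrafilters and limits of bounded functions along them\<close>

lemma ultrafilter_cases:
  assumes "ultrafilter F"
  obtains "eventually P F" | "eventually (\<lambda>x. \<not> P x) F"
  using assms unfolding ultrafilter_def by blast

lemma ultrafilter_not_bot: "ultrafilter F \<Longrightarrow> F \<noteq> bot"
  unfolding ultrafilter_def by blast

lemma ultrafilter_filtermap:
  "ultrafilter F \<Longrightarrow> ultrafilter (filtermap g F)"
  unfolding ultrafilter_def by (simp add: eventually_filtermap filtermap_bot_iff)

text \<open>Zorn's lemma for the reversed order, ultrafilters being the minimal proper filters. The
  infimum of a chain stays proper because an event of that infimum already belongs to one member. A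
  minimal proper filter decides every Q: if it does not contain the negation, adjoining Q keeps it
  proper and hence changes nothing.\<close>

lemma ultrafilter_refinement_exists:
  fixes F :: "'a filter"
  assumes "F \<noteq> bot"
  shows "\<exists>U. U \<le> F \<and> ultrafilter U"
proof -
  define A where "A = {G. G \<noteq> bot \<and> G \<le> F}"
  define P where "P = (\<lambda>a b :: 'a filter. b \<le> a)"
  have "partial_order_on A (relation_of P A)"
    unfolding P_def by (auto simp: partial_order_on_def preorder_on_def refl_on_def trans_def
        antisym_def relation_of_def)
  moreover have "\<exists>u\<in>A. \<forall>a\<in>C. P a u" if C: "C \<in> Chains (relation_of P A)" for C
  proof (cases "C = {}")
    case True
    then show ?thesis using assms unfolding A_def by auto
  next
    case False
    have CA: "C \<subseteq> A" and lin: "\<And>a b. a \<in> C \<Longrightarrow> b \<in> C \<Longrightarrow> a \<le> b \<or> b \<le> a"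
      using C unfolding Chains_def relation_of_def P_def by auto
    have "Inf C \<noteq> bot"
    proof
      assume "Inf C = bot"
      then have "eventually (\<lambda>_. False) (Inf C)" by simp
      moreover have "eventually (\<lambda>_. False) (Inf C) \<longleftrightarrow> (\<exists>b\<in>C. eventually (\<lambda>_. False) b)"
        by (rule eventually_Inf_base[OF False]) (metis lin inf.absorb1 inf.absorb2 order_refl)
      ultimately obtain b where "b \<in> C" "eventually (\<lambda>_. False) b" by blast
      then show False using CA unfolding A_def by (auto simp: trivial_limit_def)
    qed
    moreover have "Inf C \<le> F"
    proof -
      obtain c where "c \<in> C" using False by blast
      then show ?thesis using CA Inf_lower[of c C] unfolding A_def by auto
    qed
    ultimately have "Inf C \<in> A" unfolding A_def by simp
    then show ?thesis unfolding P_def by (auto intro!: bexI[of _ "Inf C"] Inf_lower)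
  qed
  ultimately obtain U where U: "U \<in> A" and max: "\<And>G. G \<in> A \<Longrightarrow> G \<le> U \<Longrightarrow> G = U"
    using predicate_Zorn[of A P] unfolding P_def by blast
  have "eventually Q U \<or> eventually (\<lambda>x. \<not> Q x) U" for Q
  proof (rule disjCI)
    assume n: "\<not> eventually (\<lambda>x. \<not> Q x) U"
    let ?G = "inf U (principal {x. Q x})"
    have "?G \<noteq> bot"
      using n by (simp add: trivial_limit_def eventually_inf_principal)
    then have "?G = U"
      using max[of ?G] U unfolding A_def by (auto intro: le_infI1)
    moreover have "eventually Q ?G"
      by (simp add: eventually_inf_principal)
    ultimately show "eventually Q U" by simp
  qed
  then show ?thesis using U unfolding A_def ultrafilter_def by blast
qed

text \<open>Compactness of [-C, C] yields a cluster point, and an ultrafilter converges to each of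
  its cluster points.\<close>

lemma ultrafilter_bounded_tendsto:
  fixes f :: "'a \<Rightarrow> real"
  assumes U: "ultrafilter U" and bd: "eventually (\<lambda>x. \<bar>f x\<bar> \<le> C) U"
  obtains l where "(f \<longlongrightarrow> l) U" "\<bar>l\<bar> \<le> C"
proof -
  have "filtermap f U \<noteq> bot" "eventually (\<lambda>y. y \<in> {-C..C}) (filtermap f U)"
    using U bd by (auto simp: ultrafilter_def filtermap_bot_iff eventually_filtermap abs_le_iff
        elim!: eventually_mono)
  then obtain l where l: "l \<in> {-C..C}" "inf (nhds l) (filtermap f U) \<noteq> bot"
    using compact_Icc[of "-C" C] unfolding compact_filter by meson
  have "(f \<longlongrightarrow> l) U"
  proof (rule topological_tendstoI)
    fix S assume S: "open S" "l \<in> S"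
    show "eventually (\<lambda>x. f x \<in> S) U"
    proof (rule ultrafilter_cases[OF U, of "\<lambda>x. f x \<in> S"])
      assume "eventually (\<lambda>x. f x \<notin> S) U"
      moreover have "eventually (\<lambda>y. y \<in> S) (nhds l)"
        using S by (rule eventually_nhds_in_open)
      ultimately have "eventually (\<lambda>_. False) (inf (nhds l) (filtermap f U))"
        unfolding eventually_inf
        by (intro exI[of _ "\<lambda>y. y \<in> S"] exI[of _ "\<lambda>y. y \<notin> S"]) (simp add: eventually_filtermap)
      then show ?thesis using l(2) by (simp add: trivial_limit_def)
    qed
  qed
  then show thesis using that l(1) by (auto simp: abs_le_iff)
qed

section \<open>Weak* limits in L-infinity along an ultrafilter\<close>

lemma bounded_mult_integrable:
  fixes f k :: "'a \<Rightarrow> real"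
  assumes [measurable]: "f \<in> borel_measurable M" and bd: "AE x in M. \<bar>f x\<bar> \<le> C" and k: "integrable M k"
  shows "integrable M (\<lambda>x. f x * k x)"
    and "\<bar>\<integral>x. f x * k x \<partial>M\<bar> \<le> C * (\<integral>x. \<bar>k x\<bar> \<partial>M)"
proof -
  have [measurable]: "k \<in> borel_measurable M" using k by auto
  have C: "integrable M (\<lambda>x. C * \<bar>k x\<bar>)" using k by auto
  have le: "AE x in M. \<bar>f x * k x\<bar> \<le> C * \<bar>k x\<bar>"
    using bd by eventually_elim (simp add: abs_mult mult_right_mono)
  show i: "integrable M (\<lambda>x. f x * k x)"
    by (rule Bochner_Integration.integrable_bound[OF C]) (use le in auto)
  have "\<bar>\<integral>x. f x * k x \<partial>M\<bar> \<le> (\<integral>x. \<bar>f x * k x\<bar> \<partial>M)"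
    using integral_abs_bound by blast
  also have "\<dots> \<le> (\<integral>x. C * \<bar>k x\<bar> \<partial>M)"
    by (rule integral_mono_AE) (use i C le in auto)
  finally show "\<bar>\<integral>x. f x * k x \<partial>M\<bar> \<le> C * (\<integral>x. \<bar>k x\<bar> \<partial>M)" by simp
qed

text \<open>Banach-Alaoglu for L-infinity as the dual of L^1. The limits \<open>L k\<close> form a
  linear functional on L^1 of norm at most C; its values on indicators determine a set function
  whose density represents it.\<close>

lemma (in finite_measure) ultrafilter_weak_star_limit_finite:
  fixes \<phi> :: "'b \<Rightarrow> 'a \<Rightarrow> real"
  assumes F: "ultrafilter F" and meas: "\<And>r. \<phi> r \<in> borel_measurable M"
    and bd: "\<And>r. AE x in M. \<bar>\<phi> r x\<bar> \<le> C"
  obtains g where "g \<in> borel_measurable M" "AE x in M. \<bar>g x\<bar> \<le> C"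
    "\<And>k. integrable M k \<Longrightarrow> ((\<lambda>r. \<integral>x. \<phi> r x * k x \<partial>M) \<longlongrightarrow> (\<integral>x. g x * k x \<partial>M)) F"
proof -
  note bot = ultrafilter_not_bot[OF F]
  note int = bounded_mult_integrable(1)[OF meas bd]
  define L where "L k = Lim F (\<lambda>r. \<integral>x. \<phi> r x * k x \<partial>M)" for k
  have L: "((\<lambda>r. \<integral>x. \<phi> r x * k x \<partial>M) \<longlongrightarrow> L k) F" "\<bar>L k\<bar> \<le> C * (\<integral>x. \<bar>k x\<bar> \<partial>M)"
    if k: "integrable M k" for k
  proof -
    obtain l where "((\<lambda>r. \<integral>x. \<phi> r x * k x \<partial>M) \<longlongrightarrow> l) F" "\<bar>l\<bar> \<le> C * (\<integral>x. \<bar>k x\<bar> \<partial>M)"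
      by (rule ultrafilter_bounded_tendsto[OF F always_eventually, OF allI])
        (rule bounded_mult_integrable(2)[OF meas bd k])
    then show "((\<lambda>r. \<integral>x. \<phi> r x * k x \<partial>M) \<longlongrightarrow> L k) F" "\<bar>L k\<bar> \<le> C * (\<integral>x. \<bar>k x\<bar> \<partial>M)"
      unfolding L_def using tendsto_Lim[OF bot] by auto
  qed
  have L_add: "L (\<lambda>x. k x + l x) = L k + L l" if k: "integrable M k" and l: "integrable M l" for k l
  proof (rule tendsto_unique[OF bot L(1)])
    have "(\<integral>x. \<phi> r x * (k x + l x) \<partial>M) = (\<integral>x. \<phi> r x * k x \<partial>M) + (\<integral>x. \<phi> r x * l x \<partial>M)" for r
      using int[OF k] int[OF l] by (simp add: distrib_left)
    then show "((\<lambda>r. \<integral>x. \<phi> r x * (k x + l x) \<partial>M) \<longlongrightarrow> L k + L l) F"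
      using tendsto_add[OF L(1)[OF k] L(1)[OF l]] by simp
  qed (use k l in auto)
  have L_mult: "L (\<lambda>x. c * k x) = c * L k" if k: "integrable M k" for k c
  proof (rule tendsto_unique[OF bot L(1)])
    have "(\<integral>x. \<phi> r x * (c * k x) \<partial>M) = c * (\<integral>x. \<phi> r x * k x \<partial>M)" for r
      by (simp add: mult.left_commute)
    then show "((\<lambda>r. \<integral>x. \<phi> r x * (c * k x) \<partial>M) \<longlongrightarrow> c * L k) F"
      using tendsto_mult_left[OF L(1)[OF k]] by simp
  qed (use k in auto)
  have ind: "integrable M (indicator A :: 'a \<Rightarrow> real)" if "A \<in> sets M" for A
    using that by (simp add: integrable_real_indicator emeasure_eq_measure)
  \<comment> \<open>Since \<open>L (indicator A)\<close> lies within C times the measure of A, this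
    shift makes the set function nonnegative, so the Radon-Nikodym theorem for positive measures
    applies. The upper bound by twice C times the measure gives continuity at the empty set and
    absolute continuity; the density is shifted back in \<open>g\<close>.\<close>
  define m where "m A = L (indicator A) + C * measure M A" for A
  have m_abs: "\<bar>L (indicator A)\<bar> \<le> C * measure M A" if "A \<in> sets M" for A
    using L(2)[OF ind[OF that]] that by simp
  have m_bounds: "0 \<le> m A" "m A \<le> 2 * (C * measure M A)" if "A \<in> sets M" for A
    using m_abs[OF that] unfolding m_def by auto
  have m_Un: "m (A \<union> B) = m A + m B" if "A \<in> sets M" "B \<in> sets M" "A \<inter> B = {}" for A B
  proof -
    have "indicator (A \<union> B) = (\<lambda>x. indicator A x + indicator B x :: real)"
      using that by (auto simp: indicator_def fun_eq_iff)
    then show ?thesis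
      using L_add[OF ind ind] that finite_measure_Union[of A B] unfolding m_def by (simp add: distrib_left)
  qed
  define N where "N = measure_of (space M) (sets M) (\<lambda>A. ennreal (m A))"
  have m0: "m A = 0" if "A \<in> sets M" "measure M A = 0" for A
    using m_bounds[OF that(1)] that(2) by simp
  have pos: "positive (sets M) (\<lambda>A. ennreal (m A))"
    unfolding positive_def using m0[of "{}"] by simp
  have cadd: "countably_additive (sets M) (\<lambda>A. ennreal (m A))"
  proof (rule sets.empty_continuous_imp_countably_additive[OF pos])
    show "additive (sets M) (\<lambda>A. ennreal (m A))"
      unfolding additive_def using m_Un m_bounds by (simp add: ennreal_plus[symmetric] del: ennreal_plus)
    fix A :: "nat \<Rightarrow> 'a set" assume A: "range A \<subseteq> sets M" "decseq A" "(\<Inter>i. A i) = {}"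
    have lim: "(\<lambda>i. 2 * (C * measure M (A i))) \<longlonglongrightarrow> 2 * (C * measure M {})"
      using finite_Lim_measure_decseq[OF A(1,2)] A(3) by (intro tendsto_intros) simp
    have "(\<lambda>i. m (A i)) \<longlonglongrightarrow> 0"
    proof (rule tendsto_sandwich[OF always_eventually always_eventually tendsto_const])
      show "(\<lambda>i. 2 * (C * measure M (A i))) \<longlonglongrightarrow> 0" using lim by simp
    qed (use m_bounds A(1) in auto)
    then show "(\<lambda>i. ennreal (m (A i))) \<longlonglongrightarrow> 0"
      using tendsto_ennrealI by fastforce
  qed simp
  have sets_N [simp]: "sets N = sets M"
    unfolding N_def by (simp add: sets.sets_measure_of_eq)
  have em_N: "emeasure N A = ennreal (m A)" if "A \<in> sets M" for A
    unfolding N_def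
    by (rule emeasure_measure_of_sigma[OF sets.sigma_algebra_axioms pos cadd that])
  have "absolutely_continuous M N"
    unfolding absolutely_continuous_def null_sets_def using em_N m0
    by (auto simp: measure_def)
  then obtain g0 where g0 [measurable]: "g0 \<in> borel_measurable M" and dens: "density M g0 = N"
    using Radon_Nikodym[of N] by auto
  have g0_int: "(\<integral>\<^sup>+x. g0 x * indicator A x \<partial>M) = ennreal (m A)" if "A \<in> sets M" for A
    using that em_N[OF that] dens emeasure_density[OF g0, of A] by simp
  have g0_total: "(\<integral>\<^sup>+x. g0 x \<partial>M) = ennreal (m (space M))"
    using g0_int[OF sets.top] nn_integral_cong[of M "\<lambda>x. g0 x * indicator (space M) x" g0] by simp
  have fin: "AE x in M. g0 x \<noteq> \<infinity>"
    by (rule nn_integral_PInf_AE) (use g0_total in auto)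
  define g1 where "g1 x = enn2real (g0 x)" for x
  have [measurable]: "g1 \<in> borel_measurable M" unfolding g1_def by measurable
  have g01: "AE x in M. ennreal (g1 x) = g0 x"
    using fin by eventually_elim (simp add: g1_def less_top)
  have g1_nn: "(\<integral>\<^sup>+x. ennreal (g1 x * indicator A x) \<partial>M) = ennreal (m A)" if "A \<in> sets M" for A
  proof -
    have "(\<integral>\<^sup>+x. ennreal (g1 x * indicator A x) \<partial>M) = (\<integral>\<^sup>+x. g0 x * indicator A x \<partial>M)"
      by (rule nn_integral_cong_AE, use g01 in eventually_elim) (auto simp: indicator_def)
    then show ?thesis using g0_int[OF that] by simp
  qed
  have g1_pos: "g1 x \<ge> 0" for x unfolding g1_def by simp
  have g1_set: "(\<integral>x. g1 x * indicator A x \<partial>M) = m A" "integrable M (\<lambda>x. g1 x * indicator A x)"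
    if A [measurable]: "A \<in> sets M" for A
    using nn_integral_eq_integrable[of "\<lambda>x. g1 x * indicator A x" M "m A"] g1_nn[OF A] m_bounds(1)[OF A] g1_pos
    by auto
  have g1_int: "integrable M g1"
    using g1_set(2)[OF sets.top] Bochner_Integration.integrable_cong[of M M g1 "\<lambda>x. g1 x * indicator (space M) x"]
    by auto
  define g where "g x = g1 x - C" for x
  have g_meas [measurable]: "g \<in> borel_measurable M" unfolding g_def by measurable
  have g_int: "integrable M g" unfolding g_def using g1_int by simp
  have g_set: "(\<integral>x. g x * indicator A x \<partial>M) = L (indicator A)" if A: "A \<in> sets M" for A
  proof -
    have "(\<integral>x. g x * indicator A x \<partial>M) = (\<integral>x. g1 x * indicator A x - C * indicator A x \<partial>M)"
      unfolding g_def by (simp add: left_diff_distrib)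
    also have "\<dots> = (\<integral>x. g1 x * indicator A x \<partial>M) - (\<integral>x. C * indicator A x \<partial>M)"
      by (rule Bochner_Integration.integral_diff) (use g1_set(2)[OF A] ind[OF A] in auto)
    finally show ?thesis using g1_set(1)[OF A] A by (simp add: m_def)
  qed
  \<comment> \<open>The mean of \<open>g\<close> over a set A of positive measure is
    \<open>L (indicator A)\<close> divided by the measure of A, a number in the closed set
    [-C, C].\<close>
  have g_bd: "AE x in M. \<bar>g x\<bar> \<le> C"
  proof -
    have "AE x in M. g x \<in> {-C..C}"
    proof (rule averaging_theorem[OF g_int])
      fix A assume A: "A \<in> sets M" "measure M A > 0"
      have "set_lebesgue_integral M A g = L (indicator A)"
        using g_set[OF A(1)] unfolding set_lebesgue_integral_def by (simp add: mult.commute)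
      then show "(1 / measure M A) *\<^sub>R set_lebesgue_integral M A g \<in> {-C..C}"
        using m_abs[OF A(1)] A(2) by (auto simp: field_simps abs_le_iff)
    qed simp
    then show ?thesis by eventually_elim (simp add: abs_le_iff)
  qed
  have gL: "(\<integral>x. g x * k x \<partial>M) = L k" if "integrable M k" for k :: "'a \<Rightarrow> real"
    using that
  proof (induction rule: integrable_induct)
    case (base A c)
    have "L (\<lambda>x. indicator A x *\<^sub>R c) = c * L (indicator A)"
      using L_mult[OF ind[OF base(1)], of c] by (simp add: mult.commute)
    moreover have "(\<integral>x. g x * (indicator A x *\<^sub>R c) \<partial>M) = c * (\<integral>x. g x * indicator A x \<partial>M)"
      by (subst integral_mult_right_zero[symmetric]) (simp add: ac_simps)
    ultimately show ?case using g_set[OF base(1)] by simp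
  next
    case (add k l)
    then show ?case
      using L_add[of k l] bounded_mult_integrable(1)[OF g_meas g_bd] by (simp add: distrib_left)
  next
    case (lim k s)
    have [measurable]: "\<And>i. s i \<in> borel_measurable M" "k \<in> borel_measurable M" using lim by auto
    have dk: "integrable M (\<lambda>x. s i x - k x)" for i using lim by auto
    have conv: "(\<lambda>i. \<integral>x. \<bar>s i x - k x\<bar> \<partial>M) \<longlonglongrightarrow> (\<integral>x. 0 \<partial>M)"
    \<comment> \<open>The approximants satisfy \<bar>s i x\<bar> \<le> 2 * \<bar>k x\<bar>, which
      accounts for the factor 3. Both functionals are then continuous along \<open>s\<close>, with
      modulus C times the L^1 distance.\<close>
    proof (rule integral_dominated_convergence[where w="\<lambda>x. 3 * \<bar>k x\<bar>"])
      show "AE x in M. (\<lambda>i. \<bar>s i x - k x\<bar>) \<longlonglongrightarrow> 0"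
        using lim.hyps(2) by (auto intro!: AE_I2 tendsto_rabs_zero simp: LIM_zero_iff)
      show "AE x in M. norm \<bar>s i x - k x\<bar> \<le> 3 * \<bar>k x\<bar>" for i
      proof (rule AE_I2)
        fix x assume "x \<in> space M"
        then show "norm \<bar>s i x - k x\<bar> \<le> 3 * \<bar>k x\<bar>" using lim.hyps(3)[of x i] by simp
      qed
    qed (use lim in auto)
    then have conv0: "(\<lambda>i. C * (\<integral>x. \<bar>s i x - k x\<bar> \<partial>M)) \<longlonglongrightarrow> 0"
      using tendsto_mult_left[OF conv, of C] by simp
    have "(\<lambda>i. L (s i) - L k) \<longlonglongrightarrow> 0"
    proof (rule Lim_null_comparison[OF always_eventually conv0], rule allI)
      fix i
      have "L (s i) = L (\<lambda>x. (s i x - k x) + k x)" by simp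
      also have "\<dots> = L (\<lambda>x. s i x - k x) + L k" using L_add[OF dk lim.hyps(4)] .
      finally show "norm (L (s i) - L k) \<le> C * (\<integral>x. \<bar>s i x - k x\<bar> \<partial>M)"
        using L(2)[OF dk] by simp
    qed
    then have 1: "(\<lambda>i. L (s i)) \<longlonglongrightarrow> L k" by (simp add: LIM_zero_iff)
    have "(\<lambda>i. (\<integral>x. g x * s i x \<partial>M) - (\<integral>x. g x * k x \<partial>M)) \<longlonglongrightarrow> 0"
    proof (rule Lim_null_comparison[OF always_eventually conv0], rule allI)
      fix i
      have "(\<integral>x. g x * s i x \<partial>M) - (\<integral>x. g x * k x \<partial>M) = (\<integral>x. g x * (s i x - k x) \<partial>M)"
        using bounded_mult_integrable(1)[OF g_meas g_bd] lim by (simp add: right_diff_distrib)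
      then show "norm ((\<integral>x. g x * s i x \<partial>M) - (\<integral>x. g x * k x \<partial>M)) \<le> C * (\<integral>x. \<bar>s i x - k x\<bar> \<partial>M)"
        using bounded_mult_integrable(2)[OF g_meas g_bd dk] by simp
    qed
    then have 2: "(\<lambda>i. L (s i)) \<longlonglongrightarrow> (\<integral>x. g x * k x \<partial>M)" using lim.IH by (simp add: LIM_zero_iff)
    show ?case by (rule LIMSEQ_unique[OF 2 1])
  qed
  show thesis
    by (rule that[OF g_meas g_bd]) (use L(1) gL in simp)
qed

text \<open>A strictly positive integrable weight \<open>w\<close> gives a finite measure with the
  same null sets, hence the same L-infinity; \<open>k\<close> is integrable for the old measure
  exactly when \<open>k / w\<close> is for the new one, with equal pairings.\<close>

lemma (in sigma_finite_measure) ultrafilter_weak_star_limit: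
  fixes \<phi> :: "'b \<Rightarrow> 'a \<Rightarrow> real"
  assumes F: "ultrafilter F" and meas: "\<And>r. \<phi> r \<in> borel_measurable M"
    and bd: "\<And>r. AE x in M. \<bar>\<phi> r x\<bar> \<le> C"
  obtains g where "g \<in> borel_measurable M" "AE x in M. \<bar>g x\<bar> \<le> C"
    "\<And>k. integrable M k \<Longrightarrow> ((\<lambda>r. \<integral>x. \<phi> r x * k x \<partial>M) \<longlongrightarrow> (\<integral>x. g x * k x \<partial>M)) F"
proof -
  obtain w :: "'a \<Rightarrow> real" where w [measurable]: "w \<in> borel_measurable M" and w_pos: "\<And>x. w x > 0"
    and w_int: "integrable M w"
    using obtain_positive_integrable_function by metis
  define N where "N = density M (\<lambda>x. ennreal (w x))"
  have w_nn: "(\<integral>\<^sup>+x. ennreal (w x) \<partial>M) < \<infinity>"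
    using w_int w_pos by (simp add: integrable_iff_bounded less_imp_le)
  interpret N: finite_measure N
  proof
    have "(\<integral>\<^sup>+x. ennreal (w x) * indicator (space M) x \<partial>M) = (\<integral>\<^sup>+x. ennreal (w x) \<partial>M)"
      by (rule nn_integral_cong) simp
    then show "emeasure N (space N) \<noteq> \<infinity>"
      unfolding N_def using w_nn by (simp add: emeasure_density)
  qed
  have AE_N: "(AE x in N. P x) \<longleftrightarrow> (AE x in M. P x)" for P
    unfolding N_def using w_pos by (simp add: AE_density)
  have meas_N: "borel_measurable N = (borel_measurable M :: ('a \<Rightarrow> real) set)"
    unfolding N_def by (rule measurable_cong_sets) auto
  obtain g where g: "g \<in> borel_measurable N" "AE x in N. \<bar>g x\<bar> \<le> C"
    "\<And>k. integrable N k \<Longrightarrow> ((\<lambda>r. \<integral>x. \<phi> r x * k x \<partial>N) \<longlongrightarrow> (\<integral>x. g x * k x \<partial>N)) F"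
    using N.ultrafilter_weak_star_limit_finite[OF F, of \<phi> C] meas bd unfolding AE_N meas_N by blast
  have gM [measurable]: "g \<in> borel_measurable M" using g(1) meas_N by simp
  show thesis
  proof (rule that[OF gM])
    show "AE x in M. \<bar>g x\<bar> \<le> C" using g(2) AE_N by simp
    fix k :: "'a \<Rightarrow> real" assume k: "integrable M k"
    have [measurable]: "k \<in> borel_measurable M" "\<And>r. \<phi> r \<in> borel_measurable M" using k meas by auto
    have wk: "w x * (h x * (k x / w x)) = h x * k x" for h x using w_pos[of x] by simp
    have "integrable N (\<lambda>x. k x / w x)"
      unfolding N_def using k w_pos by (subst integrable_real_density) (auto simp: less_imp_le less_imp_neq[symmetric])
    moreover have "(\<integral>x. h x * (k x / w x) \<partial>N) = (\<integral>x. h x * k x \<partial>M)" if [measurable]: "h \<in> borel_measurable M" for h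
      unfolding N_def using w_pos by (subst integral_real_density) (auto simp: less_imp_le wk simp del: times_divide_eq_right)
    ultimately show "((\<lambda>r. \<integral>x. \<phi> r x * k x \<partial>M) \<longlongrightarrow> (\<integral>x. g x * k x \<partial>M)) F"
      using g(3)[of "\<lambda>x. k x / w x"] meas by simp
  qed
qed

section \<open>Integrals against dt/t in the logarithmic variable\<close>

text \<open>With \<open>u\<close> as the logarithm of the endpoint, dilation by \<open>exp u\<close>
  becomes translation by \<open>u\<close>, and an essential bound on \<open>f\<close> becomes a
  Lipschitz constant.\<close>

definition logint :: "(real \<Rightarrow> real) \<Rightarrow> real \<Rightarrow> real" where
  "logint f u = (LINT t:{1..exp u}|lborel. f t / t)"

lemma Linf_measurable: "f \<in> Linf \<Longrightarrow> (\<lambda>t. indicator {1..} t * f t) \<in> borel_measurable lborel"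
  unfolding Linf_def set_borel_measurable_def by simp

lemma Linf_bound:
  assumes "f \<in> Linf"
  obtains C where "C \<ge> 0" "AE t in lborel. t \<ge> 1 \<longrightarrow> \<bar>f t\<bar> \<le> C"
proof -
  obtain C where C: "AE t in lborel. t \<ge> 1 \<longrightarrow> \<bar>f t\<bar> \<le> C"
    using assms unfolding Linf_def by auto
  show thesis
  proof (rule that[of "max C 0"])
    show "AE t in lborel. t \<ge> 1 \<longrightarrow> \<bar>f t\<bar> \<le> max C 0" using C by eventually_elim auto
  qed simp
qed

lemma Linf_const: "(\<lambda>_. c) \<in> Linf"
  unfolding Linf_def set_borel_measurable_def by auto

lemma Linf_lincomb:
  assumes f: "f \<in> Linf" and g: "g \<in> Linf"
  shows "(\<lambda>t. a * f t + b * g t) \<in> Linf"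
proof -
  obtain C where C: "AE t in lborel. t \<ge> 1 \<longrightarrow> \<bar>f t\<bar> \<le> C" using Linf_bound[OF f] by blast
  obtain D where D: "AE t in lborel. t \<ge> 1 \<longrightarrow> \<bar>g t\<bar> \<le> D" using Linf_bound[OF g] by blast
  have "AE t in lborel. t \<ge> 1 \<longrightarrow> \<bar>a * f t + b * g t\<bar> \<le> \<bar>a\<bar> * C + \<bar>b\<bar> * D"
    using C D
  proof eventually_elim
    case (elim t)
    have "\<bar>a * f t + b * g t\<bar> \<le> \<bar>a\<bar> * \<bar>f t\<bar> + \<bar>b\<bar> * \<bar>g t\<bar>"
      by (metis abs_mult abs_triangle_ineq)
    then show ?case using elim by (smt (verit) mult_left_mono abs_ge_zero)
  qed
  moreover have "(\<lambda>t. indicator {1..} t * (a * f t + b * g t)) \<in> borel_measurable lborel"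
  proof -
    have "(\<lambda>t. indicator {1..} t * (a * f t + b * g t))
        = (\<lambda>t. a * (indicator {1..} t * f t) + b * (indicator {1..} t * g t))"
      by (auto simp: algebra_simps)
    then show ?thesis using Linf_measurable[OF f] Linf_measurable[OF g] by simp
  qed
  ultimately show ?thesis unfolding Linf_def set_borel_measurable_def by auto
qed

lemma integral_inverse_Icc:
  assumes "0 < a" "a \<le> b"
  shows "set_integrable lborel {a..b} (\<lambda>t::real. 1 / t)"
    and "(LINT t:{a..b}|lborel. 1 / t) = ln b - ln a"
proof -
  have d: "DERIV ln x :> 1 / x" and c: "isCont (\<lambda>t. 1 / t) x" if "a \<le> x" for x :: real
    using that assms by (auto intro!: derivative_eq_intros continuous_intros)
  show "set_integrable lborel {a..b} (\<lambda>t::real. 1 / t)"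
    by (rule borel_integrable_atLeastAtMost') (use assms in \<open>auto intro!: continuous_intros\<close>)
  show "(LINT t:{a..b}|lborel. 1 / t) = ln b - ln a"
    using integral_FTC_Icc_real[OF assms(2), of ln "\<lambda>t. 1 / t"] d c
    by (simp add: set_lebesgue_integral_def mult.commute)
qed

lemma Linf_set_integral_Icc:
  assumes f: "f \<in> Linf" and ab: "1 \<le> a" "a \<le> b"
  shows "set_integrable lborel {a..b} (\<lambda>t. f t / t)"
    and "(AE t in lborel. t \<ge> 1 \<longrightarrow> \<bar>f t\<bar> \<le> C) \<Longrightarrow> \<bar>LINT t:{a..b}|lborel. f t / t\<bar> \<le> C * (ln b - ln a)"
proof -
  note [measurable] = Linf_measurable[OF f]
  let ?k = "\<lambda>t::real. indicator {a..b} t * (1 / t)"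
  let ?f = "\<lambda>t. indicator {1..} t * f t"
  have eq: "indicator {a..b} t *\<^sub>R (f t / t) = ?f t * ?k t" for t
    using ab by (auto simp: indicator_def)
  have k: "integrable lborel ?k"
    using integral_inverse_Icc(1)[of a b] ab unfolding set_integrable_def by simp
  have bd: "AE t in lborel. \<bar>?f t\<bar> \<le> C" if "AE t in lborel. t \<ge> 1 \<longrightarrow> \<bar>f t\<bar> \<le> C" "C \<ge> 0" for C
    using that(1) by eventually_elim (use that(2) in \<open>auto simp: indicator_def\<close>)
  obtain C0 where "C0 \<ge> 0" "AE t in lborel. t \<ge> 1 \<longrightarrow> \<bar>f t\<bar> \<le> C0" by (rule Linf_bound[OF f])
  then show "set_integrable lborel {a..b} (\<lambda>t. f t / t)"
    unfolding set_integrable_def eq using bounded_mult_integrable(1)[OF _ bd k] by simp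
  assume C: "AE t in lborel. t \<ge> 1 \<longrightarrow> \<bar>f t\<bar> \<le> C"
  \<comment> \<open>The extension of \<open>f\<close> by 0 is bounded by C only for C \<ge> 0. A
    negative C would contradict the almost everywhere bound on [1, 2], a set of positive
    measure.\<close>
  have "C \<ge> 0"
  proof (rule ccontr)
    assume "\<not> C \<ge> 0"
    then have "AE t in lborel. t \<notin> {1..2::real}" using C by (auto elim!: eventually_mono)
    then have "emeasure lborel {1..2::real} = 0"
      by (subst (asm) AE_iff_measurable[of "{1..2::real}"]) auto
    then show False by simp
  qed
  have "(\<integral>t. \<bar>?k t\<bar> \<partial>lborel) = (LINT t:{a..b}|lborel. 1 / t)"
    unfolding set_lebesgue_integral_def
    by (rule Bochner_Integration.integral_cong) (use ab in \<open>auto simp: indicator_def\<close>)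
  then show "\<bar>LINT t:{a..b}|lborel. f t / t\<bar> \<le> C * (ln b - ln a)"
    using bounded_mult_integrable(2)[OF _ bd[OF C \<open>C \<ge> 0\<close>] k] integral_inverse_Icc(2)[of a b] ab
    unfolding set_lebesgue_integral_def eq by simp
qed

lemma logint_increment:
  assumes f: "f \<in> Linf" and "0 \<le> u" "0 \<le> T"
  shows "(LINT t:{exp u..exp (u + T)}|lborel. f t / t) = logint f (u + T) - logint f u"
proof -
  have "{1..exp (u + T)} = {1..exp u} \<union> {exp u..exp (u + T)}"
    using assms by (intro ivl_disj_un_two_touch(4)[symmetric]) auto
  moreover have "(LINT t:{1..exp u} \<union> {exp u..exp (u + T)}|lborel. f t / t)
      = (LINT t:{1..exp u}|lborel. f t / t) + (LINT t:{exp u..exp (u + T)}|lborel. f t / t)"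
  proof (rule set_integral_Un_AE)
    show "AE t in lborel. \<not> (t \<in> {1..exp u} \<and> t \<in> {exp u..exp (u + T)})"
      using AE_lborel_singleton[of "exp u"] by eventually_elim auto
  qed (use Linf_set_integral_Icc(1)[OF f] assms in auto)
  ultimately show ?thesis unfolding logint_def by simp
qed

lemma logint_lipschitz:
  assumes f: "f \<in> Linf" and C: "AE t in lborel. t \<ge> 1 \<longrightarrow> \<bar>f t\<bar> \<le> C" and "0 \<le> u" "0 \<le> T"
  shows "\<bar>logint f (u + T) - logint f u\<bar> \<le> C * T"
  using Linf_set_integral_Icc(2)[OF f _ _ C, of "exp u" "exp (u + T)"] assms
  by (simp add: logint_increment)

lemma logint_lincomb:
  assumes f: "f \<in> Linf" and g: "g \<in> Linf" and u: "0 \<le> u"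
  shows "logint (\<lambda>t. a * f t + b * g t) u = a * logint f u + b * logint g u"
proof -
  have i: "set_integrable lborel {1..exp u} (\<lambda>t. f t / t)" "set_integrable lborel {1..exp u} (\<lambda>t. g t / t)"
    using Linf_set_integral_Icc(1) f g u by auto
  have "logint (\<lambda>t. a * f t + b * g t) u = (LINT t:{1..exp u}|lborel. a * (f t / t) + b * (g t / t))"
    unfolding logint_def by (simp add: add_divide_distrib)
  also have "\<dots> = a * logint f u + b * logint g u"
    using i unfolding logint_def
    by (subst set_integral_add) (auto simp del: times_divide_eq_right)
  finally show ?thesis .
qed

lemma logint_one: "0 \<le> u \<Longrightarrow> logint (\<lambda>_. 1) u = u"
  unfolding logint_def using integral_inverse_Icc(2)[of 1 "exp u"] by simp

lemma logint_mono:
  assumes f: "f \<in> Linf" and nn: "AE t in lborel. t \<ge> 1 \<longrightarrow> f t \<ge> 0" and uT: "0 \<le> u" "0 \<le> T"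
  shows "logint f u \<le> logint f (u + T)"
proof -
  have "0 \<le> (LINT t:{exp u..exp (u + T)}|lborel. f t / t)"
    unfolding set_lebesgue_integral_def
  proof (rule integral_nonneg_AE)
    show "AE t in lborel. 0 \<le> indicator {exp u..exp (u + T)} t *\<^sub>R (f t / t)"
      using nn
    proof eventually_elim
      case (elim t)
      have "t \<ge> 1" if "exp u \<le> t" using that uT(1) by (smt (verit) one_le_exp_iff)
      then show ?case using elim by (auto simp: indicator_def)
    qed
  qed
  then show ?thesis using logint_increment[OF f uT] by simp
qed

text \<open>The measure dt/t is invariant under dilations, so integrals of \<open>f (r * t)\<close>
  over [1, exp T] are increments of \<open>logint f\<close>.\<close>

lemma logint_dilation:
  assumes f: "f \<in> Linf" and "0 \<le> u" "0 \<le> T"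
  shows "(LINT t:{1..exp T}|lborel. f (exp u * t) / t) = logint f (u + T) - logint f u"
proof -
  have "(LINT t:{exp u..exp (u + T)}|lborel. f t / t) =
    exp u *\<^sub>R (LINT t|lborel. indicator {exp u..exp (u + T)} (0 + exp u * t) *\<^sub>R (f (0 + exp u * t) / (0 + exp u * t)))"
    unfolding set_lebesgue_integral_def by (subst lborel_integral_real_affine[of "exp u" _ 0]) auto
  also have "\<dots> = (LINT t|lborel. exp u * (indicator {exp u..exp (u + T)} (exp u * t) * (f (exp u * t) / (exp u * t))))"
    by (simp only: integral_mult_right_zero real_scaleR_def add_0)
  also have "\<dots> = (LINT t:{1..exp T}|lborel. f (exp u * t) / t)"
    unfolding set_lebesgue_integral_def
    by (rule Bochner_Integration.integral_cong) (auto simp: indicator_def exp_add)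
  finally show ?thesis using logint_increment[OF assms] by simp
qed

section \<open>Existence of the limits of dilated functions\<close>

lemma is_mult_limit_exists:
  assumes f: "f \<in> Linf" and \<eta>: "ultrafilter \<eta>" and s: "0 \<le> s"
  shows "\<exists>g. is_mult_limit f (exp_omega \<eta> s) g"
proof -
  obtain C where C: "C \<ge> 0" "AE t in lborel. t \<ge> 1 \<longrightarrow> \<bar>f t\<bar> \<le> C" by (rule Linf_bound[OF f])
  define F where "F = (\<lambda>t. indicator {1..} t * f t)"
  have [measurable]: "F \<in> borel_measurable borel" using Linf_measurable[OF f] unfolding F_def by simp
  have F_bd: "AE t in lborel. \<bar>F t\<bar> \<le> C"
    using C(2) by eventually_elim (use C(1) in \<open>auto simp: F_def indicator_def\<close>)
  \<comment> \<open>The summand 0 gives the affine form for which preservation of null sets is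
    available. For t \<ge> 1 the argument is at least 1, because s \<ge> 0, so the extension of
    \<open>f\<close> by 0 is not visible in the integrals over [1, oo).\<close>
  define \<phi> where "\<phi> n t = F (0 + exp (real n + s) * t)" for n t
  have meas: "\<phi> n \<in> borel_measurable lborel" for n
    unfolding \<phi>_def by measurable
  have bd: "AE t in lborel. \<bar>\<phi> n t\<bar> \<le> C" for n
    unfolding \<phi>_def by (rule AE_borel_affine[OF _ _ F_bd]) auto
  obtain g where g: "g \<in> borel_measurable lborel" "AE t in lborel. \<bar>g t\<bar> \<le> C"
    "\<And>k. integrable lborel k \<Longrightarrow>
      ((\<lambda>n. \<integral>t. \<phi> n t * k t \<partial>lborel) \<longlongrightarrow> (\<integral>t. g t * k t \<partial>lborel)) \<eta>"
    using lborel.ultrafilter_weak_star_limit[of \<eta> \<phi> C, OF \<eta> meas bd] by blast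
  have "is_mult_limit f (exp_omega \<eta> s) g"
    unfolding is_mult_limit_def
  proof (intro conjI ballI)
    have "AE t in lborel. t \<ge> 1 \<longrightarrow> \<bar>g t\<bar> \<le> C" using g(2) by eventually_elim simp
    then show "g \<in> Linf" using g(1) unfolding Linf_def set_borel_measurable_def by auto
    fix h assume "h \<in> L1mult"
    then have k: "integrable lborel (\<lambda>t. indicator {1..} t * (h t / t))"
      unfolding L1mult_def set_integrable_def by simp
    have 1: "(\<integral>t. \<phi> n t * (indicator {1..} t * (h t / t)) \<partial>lborel)
        = (LINT t:{1..}|lborel. f (exp (real n + s) * t) * h t / t)" for n
      unfolding set_lebesgue_integral_def
    proof (rule Bochner_Integration.integral_cong)
      fix t :: real
      have "exp (real n + s) * t \<ge> 1" if "t \<ge> 1"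
        using mult_mono[of 1 "exp (real n + s)" 1 t] that s by simp
      then show "\<phi> n t * (indicator {1..} t * (h t / t)) = indicator {1..} t *\<^sub>R (f (exp (real n + s) * t) * h t / t)"
        by (auto simp: \<phi>_def F_def indicator_def)
    qed simp
    have 2: "(\<integral>t. g t * (indicator {1..} t * (h t / t)) \<partial>lborel) = (LINT t:{1..}|lborel. g t * h t / t)"
      unfolding set_lebesgue_integral_def by (rule Bochner_Integration.integral_cong) auto
    show "((\<lambda>r. LINT t:{1..}|lborel. f (r * t) * h t / t)
        \<longlongrightarrow> (LINT t:{1..}|lborel. g t * h t / t)) (exp_omega \<eta> s)"
      using g(3)[OF k] unfolding exp_omega_def filterlim_filtermap 1 2 .
  qed
  then show ?thesis by blast
qed

text \<open>The weak* limit tested against the indicator of [1, exp T]. All later facts about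
  \<open>mult_limit\<close> come from this convergence.\<close>

lemma logint_increment_tendsto_mult_limit:
  assumes f: "f \<in> Linf" and \<eta>: "Omega_star_pt \<eta> s" and T: "0 \<le> T"
  shows "((\<lambda>n. logint f (real n + s + T) - logint f (real n + s))
      \<longlongrightarrow> (LINT t:{1..exp T}|lborel. mult_limit f \<eta> s t / t)) \<eta>"
proof -
  have s: "s \<ge> 0" and "ultrafilter \<eta>" using \<eta> unfolding Omega_star_pt_def by auto
  then have lim: "is_mult_limit f (exp_omega \<eta> s) (mult_limit f \<eta> s)"
    unfolding mult_limit_def using is_mult_limit_exists[OF f] by (metis someI_ex)
  let ?h = "indicator {1..exp T} :: real \<Rightarrow> real"
  have eq: "(LINT t:{1..}|lborel. g t * ?h t / t) = (LINT t:{1..exp T}|lborel. g t / t)" for g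
    unfolding set_lebesgue_integral_def
    by (rule Bochner_Integration.integral_cong) (auto simp: indicator_def)
  have "(\<lambda>t. indicator {1..} t *\<^sub>R (?h t / t)) = (\<lambda>t. indicator {1..exp T} t *\<^sub>R (1 / t))"
    by (auto simp: indicator_def)
  then have "?h \<in> L1mult"
    using integral_inverse_Icc(1)[of 1 "exp T"] T unfolding L1mult_def set_integrable_def by simp
  then have "((\<lambda>r. LINT t:{1..exp T}|lborel. f (r * t) / t)
      \<longlongrightarrow> (LINT t:{1..exp T}|lborel. mult_limit f \<eta> s t / t)) (exp_omega \<eta> s)"
    using lim unfolding is_mult_limit_def eq[symmetric] by blast
  then show ?thesis
    unfolding exp_omega_def filterlim_filtermap using logint_dilation[OF f _ T] s by simp
qed

section \<open>Asymptotic upper slope of a Lipschitz function\<close>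

text \<open>The limsup over u of \<open>H (u + T) - H u\<close> is subadditive in T, so by Fekete's
  argument its quotient by T tends to its infimum. Defining the slope as the infimum gives one of
  the two estimates at every single length T.\<close>

definition upper_slope :: "(real \<Rightarrow> real) \<Rightarrow> real" where
  "upper_slope H = Inf {m. \<exists>T>0. eventually (\<lambda>u. H (u + T) - H u \<le> m * T) at_top}"

lemma upper_slope_less:
  assumes lip: "\<And>u T. 0 \<le> u \<Longrightarrow> 0 \<le> T \<Longrightarrow> \<bar>H (u + T) - H u\<bar> \<le> C * T"
    and m: "upper_slope H < m"
  obtains T k where "T > 0" "k < m" "eventually (\<lambda>u. H (u + T) - H u \<le> k * T) at_top"
proof -
  have "eventually (\<lambda>u. H (u + 1) - H u \<le> C * 1) at_top"
    using eventually_ge_at_top[of 0] by eventually_elim (use lip[of _ 1] in force)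
  then have "C \<in> {m. \<exists>T>0. eventually (\<lambda>u. H (u + T) - H u \<le> m * T) at_top}"
    by (auto intro: exI[of _ 1])
  then have "{m. \<exists>T>0. eventually (\<lambda>u. H (u + T) - H u \<le> m * T) at_top} \<noteq> {}" by blast
  from cInf_lessD[OF this m[unfolded upper_slope_def]]
  obtain k where "k < m" "\<exists>T>0. eventually (\<lambda>u. H (u + T) - H u \<le> k * T) at_top" by blast
  then show thesis using that by blast
qed

text \<open>Otherwise \<open>m\<close> would belong to the set whose infimum is
  \<open>upper_slope H\<close>. The Lipschitz constant bounds that set below by -C, without which a
  real \<open>Inf\<close> is no lower bound.\<close>

lemma frequently_increment_gt:
  assumes lip: "\<And>u T. 0 \<le> u \<Longrightarrow> 0 \<le> T \<Longrightarrow> \<bar>H (u + T) - H u\<bar> \<le> C * T"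
    and m: "m < upper_slope H" and T: "T > 0"
  shows "frequently (\<lambda>u. m * T < H (u + T) - H u) at_top"
proof (rule ccontr)
  let ?D = "{m. \<exists>T>0. eventually (\<lambda>u. H (u + T) - H u \<le> m * T) at_top}"
  assume "\<not> ?thesis"
  then have "m \<in> ?D" using T by (auto simp: frequently_def not_less)
  moreover have "bdd_below ?D"
  proof (rule bdd_belowI)
    fix k assume "k \<in> ?D"
    then obtain S where S: "S > 0" "eventually (\<lambda>u. H (u + S) - H u \<le> k * S) at_top" by blast
    then obtain u where "u \<ge> 0" "H (u + S) - H u \<le> k * S"
      using eventually_happens[OF eventually_conj[OF eventually_ge_at_top[of 0] S(2)]] by auto
    then have "- C * S \<le> k * S" using lip[of u S] S(1) by (simp add: abs_le_iff)
    then show "- C \<le> k" using S(1) mult_le_cancel_right_pos by blast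
  qed
  ultimately have "upper_slope H \<le> m" unfolding upper_slope_def by (rule cInf_lower)
  then show False using m by simp
qed

lemma increment_iterate:
  assumes "\<And>u. u \<ge> X \<Longrightarrow> H (u + T) - H u \<le> k * T" "u \<ge> X" "(T::real) > 0"
  shows "H (u + real n * T) - H u \<le> k * (real n * T)"
proof (induction n)
  case (Suc n)
  have "H (u + real n * T + T) - H (u + real n * T) \<le> k * T"
    by (rule assms(1)) (use assms in \<open>auto intro: add_increasing2\<close>)
  then show ?case using Suc by (simp add: algebra_simps)
qed simp

text \<open>Fekete's argument: one good length S with slope k < m tiles [u, u + T] up to a remainder
  of length at most S. The remainder costs at most (C + \<bar>k\<bar>) * S, which the gain (m - k) *
  T absorbs once T passes the threshold below.\<close>

lemma eventually_increment_le:
  assumes lip: "\<And>u T. 0 \<le> u \<Longrightarrow> 0 \<le> T \<Longrightarrow> \<bar>H (u + T) - H u\<bar> \<le> C * T"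
    and m: "upper_slope H < m"
  shows "eventually (\<lambda>T. eventually (\<lambda>u. H (u + T) - H u \<le> m * T) at_top) at_top"
proof -
  obtain S k where S: "S > 0" "k < m" "eventually (\<lambda>u. H (u + S) - H u \<le> k * S) at_top"
    using upper_slope_less[OF lip m] by blast
  obtain X where X: "\<And>u. u \<ge> X \<Longrightarrow> H (u + S) - H u \<le> k * S"
    using S(3) unfolding eventually_at_top_linorder by blast
  have C: "C \<ge> 0" using lip[of 0 1] by simp
  have "H (u + T) - H u \<le> m * T" if T: "T \<ge> max 0 ((C + \<bar>k\<bar>) * S / (m - k))" and u: "u \<ge> max 0 X" for T u
  proof -
    define n where "n = nat \<lfloor>T / S\<rfloor>"
    define r where "r = T - real n * S"
    have n: "real n = of_int \<lfloor>T / S\<rfloor>" unfolding n_def using T S(1) by simp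
    have "real n \<le> T / S" "T / S < real n + 1" unfolding n by linarith+
    then have r: "0 \<le> r" "r \<le> S" unfolding r_def using S(1) by (auto simp: field_simps)
    have 1: "H (u + real n * S) - H u \<le> k * (real n * S)"
      by (rule increment_iterate[where X = X]) (use X u S(1) in auto)
    have "H (u + real n * S + r) - H (u + real n * S) \<le> C * r"
      using lip[of "u + real n * S" r] u r S(1) by (simp add: abs_le_iff)
    also have "\<dots> \<le> C * S" using C r by (simp add: mult_left_mono)
    finally have 2: "H (u + T) - H (u + real n * S) \<le> C * S" unfolding r_def by simp
    have "k * (real n * S) = k * T - k * r" unfolding r_def by (simp add: algebra_simps)
    also have "\<dots> \<le> k * T + \<bar>k\<bar> * S"
      using r mult_mono[of "-k" "\<bar>k\<bar>" r S] by simp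
    finally have "H (u + T) - H u \<le> k * T + (C + \<bar>k\<bar>) * S" using 1 2 by (simp add: algebra_simps)
    also have "\<dots> \<le> m * T" using T S(2) by (simp add: field_simps)
    finally show ?thesis .
  qed
  then show ?thesis
    by (auto simp: eventually_at_top_linorder simp del: max.bounded_iff)
qed

text \<open>A stretch of slope nearly \<open>upper_slope H\<close> need not be steep at every scale, but the
  minimiser of \<open>H v - (upper_slope H - \<epsilon>) * v\<close> over a long such stretch starts one that is.\<close>

lemma steep_start_exists:
  assumes lip: "\<And>u T. 0 \<le> u \<Longrightarrow> 0 \<le> T \<Longrightarrow> \<bar>H (u + T) - H u\<bar> \<le> C * T"
    and eps: "\<epsilon> > 0" and S: "S \<ge> 0"
  obtains u where "u \<ge> X" "u \<ge> 0" "\<And>t. 0 \<le> t \<Longrightarrow> t \<le> S \<Longrightarrow> (upper_slope H - \<epsilon>) * t \<le> H (u + t) - H u"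
proof -
  define m where "m = upper_slope H - \<epsilon>"
  define G where "G v = H v - m * v" for v
  define K where "K = C + \<bar>m\<bar>"
  have C: "C \<ge> 0" using lip[of 0 1] by simp
  have G_lip: "\<bar>G (u + T) - G u\<bar> \<le> K * T" if "0 \<le> u" "0 \<le> T" for u T
  proof -
    have "G (u + T) - G u = (H (u + T) - H u) - m * T" unfolding G_def by (simp add: algebra_simps)
    then have "\<bar>G (u + T) - G u\<bar> \<le> \<bar>H (u + T) - H u\<bar> + \<bar>m * T\<bar>" by simp
    also have "\<dots> \<le> C * T + \<bar>m\<bar> * T" using lip[OF that] that by (simp add: abs_mult)
    finally show ?thesis unfolding K_def by (simp add: algebra_simps)
  qed
  have G_dist: "\<bar>G x - G y\<bar> \<le> K * \<bar>x - y\<bar>" if "0 \<le> x" "0 \<le> y" for x y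
    using G_lip[of x "y - x"] G_lip[of y "x - y"] that by (cases "x \<le> y") (auto simp: abs_minus_commute)
  have G_cont: "continuous_on {0..} G"
    by (rule lipschitz_on_continuous_on[OF lipschitz_onI[of "{0..}" G K]])
      (use G_dist C in \<open>auto simp: dist_real_def K_def\<close>)
  \<comment> \<open>Slope above \<open>upper_slope H - \<epsilon> / 2\<close> over length T makes
    \<open>G\<close> rise by more than \<epsilon> / 2 * T, hence by more than K * S. If the
    minimiser were within S of the right end, the Lipschitz bound would allow a rise of at most K *
    S. So the minimiser leaves room for length S.\<close>
  define T where "T = max (S + 1) (2 * (K * S + 1) / \<epsilon>)"
  have T: "T > 0" "T \<ge> S" "\<epsilon> / 2 * T \<ge> K * S + 1"
  proof -
    have "T \<ge> S + 1" "T \<ge> 2 * (K * S + 1) / \<epsilon>" unfolding T_def by auto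
    then show "T > 0" "T \<ge> S" "\<epsilon> / 2 * T \<ge> K * S + 1" using S eps by (auto simp: field_simps)
  qed
  have "frequently (\<lambda>u. (upper_slope H - \<epsilon> / 2) * T < H (u + T) - H u) at_top"
    by (rule frequently_increment_gt[OF lip _ T(1)]) (use eps in auto)
  then obtain v where v: "v \<ge> max X 0" "(upper_slope H - \<epsilon> / 2) * T < H (v + T) - H v"
    using frequently_eventually_frequently[OF _ eventually_ge_at_top[of "max X 0"]]
    by (blast dest: frequently_ex)
  have rise: "\<epsilon> / 2 * T < G (v + T) - G v"
    using v(2) unfolding G_def m_def by (simp add: algebra_simps)
  obtain u where u: "u \<in> {v..v + T}" and min: "\<And>y. y \<in> {v..v + T} \<Longrightarrow> G u \<le> G y"
    using continuous_attains_inf[of "{v..v + T}" G] continuous_on_subset[OF G_cont, of "{v..v + T}"] T(1) v(1)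
    by auto
  have uS: "u + S \<le> v + T"
  proof (rule ccontr)
    assume "\<not> ?thesis"
    then have "\<bar>v + T - u\<bar> \<le> S" using u by auto
    then have "K * \<bar>v + T - u\<bar> \<le> K * S" using C by (intro mult_left_mono) (auto simp: K_def)
    then have "G (v + T) - G u \<le> K * S" using G_dist[of "v + T" u] u v(1) T(1) by auto
    moreover have "G u \<le> G v" using min[of v] T(1) by auto
    ultimately show False using rise T(3) by linarith
  qed
  show thesis
  proof (rule that[of u])
    fix t assume "0 \<le> t" "t \<le> S"
    then have "G u \<le> G (u + t)" using min[of "u + t"] u uS by auto
    then show "(upper_slope H - \<epsilon>) * t \<le> H (u + t) - H u"
      unfolding G_def m_def by (simp add: algebra_simps)
  qed (use u v in auto)
qed

text \<open>\<open>Lim\<close> is meaningful only for a convergent function, so convergence is part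
  of the work. The lower bound holds at every \<theta> > 1, the slope being an infimum over lengths;
  the upper bound holds only for large \<theta>.\<close>

lemma upper_mean_eq:
  assumes f: "f \<in> Linf"
  shows "upper_mean f = ereal (upper_slope (logint f))"
proof -
  let ?M = "upper_slope (logint f)"
  obtain C where "AE t in lborel. t \<ge> 1 \<longrightarrow> \<bar>f t\<bar> \<le> C" by (rule Linf_bound[OF f])
  note lip = logint_lipschitz[OF f this]
  define e where "e \<theta> x = 1 / ln \<theta> * (LINT t:{x..\<theta> * x}|lborel. f t / t)" for \<theta> x
  have e: "e (exp T) (exp u) = (logint f (u + T) - logint f u) / T" if "u \<ge> 0" "T > 0" for u T
    using logint_increment[OF f, of u T] that unfolding e_def by (simp add: exp_add mult.commute)
  define Q where "Q \<theta> = Limsup at_top (\<lambda>x. ereal (e \<theta> x))" for \<theta>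
  have lower: "ereal ?M \<le> Q \<theta>" if "\<theta> > 1" for \<theta>
  proof (rule ccontr)
    assume "\<not> ?thesis"
    then obtain m where m: "Q \<theta> < ereal m" "m < ?M" using ereal_dense2[of "Q \<theta>" "ereal ?M"] by (auto simp: not_le)
    define T where "T = ln \<theta>"
    have T: "T > 0" "\<theta> = exp T" unfolding T_def using that by auto
    have "eventually (\<lambda>x. ereal (e \<theta> x) < ereal m) at_top"
      using Limsup_lessD[OF m(1)[unfolded Q_def]] .
    from eventually_compose_filterlim[OF this exp_at_top]
    have "eventually (\<lambda>u. e \<theta> (exp u) < m) at_top" by simp
    then have "eventually (\<lambda>u. \<not> m * T < logint f (u + T) - logint f u) at_top"
      using eventually_ge_at_top[of 0]
      by eventually_elim (use T e in \<open>auto simp: field_simps not_less\<close>)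
    moreover have "frequently (\<lambda>u. m * T < logint f (u + T) - logint f u) at_top"
      by (rule frequently_increment_gt[OF _ m(2) T(1)]) (rule lip)
    ultimately show False by (simp add: frequently_def)
  qed
  have upper: "eventually (\<lambda>\<theta>. Q \<theta> \<le> ereal m) at_top" if "m > ?M" for m
  proof -
    have "eventually (\<lambda>T. T > 0 \<and> eventually (\<lambda>u. logint f (u + T) - logint f u \<le> m * T) at_top) at_top"
    proof (intro eventually_conj)
      show "eventually (\<lambda>T. eventually (\<lambda>u. logint f (u + T) - logint f u \<le> m * T) at_top) at_top"
        by (rule eventually_increment_le[OF _ that]) (rule lip)
    qed (rule eventually_gt_at_top)
    from eventually_compose_filterlim[OF this ln_at_top]
    have "eventually (\<lambda>\<theta>. ln \<theta> > 0 \<and> eventually (\<lambda>u. logint f (u + ln \<theta>) - logint f u \<le> m * ln \<theta>) at_top) at_top" by simp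
    then show ?thesis
      using eventually_gt_at_top[of 0]
    proof eventually_elim
      case (elim \<theta>)
      then have \<theta>: "ln \<theta> > 0" "\<theta> > 0" by auto
      have "eventually (\<lambda>u. logint f (u + ln \<theta>) - logint f u \<le> m * ln \<theta>) at_top" using elim by blast
      from eventually_compose_filterlim[OF this ln_at_top]
      have "eventually (\<lambda>x. logint f (ln x + ln \<theta>) - logint f (ln x) \<le> m * ln \<theta>) at_top" by simp
      then have "eventually (\<lambda>x. ereal (e \<theta> x) \<le> ereal m) at_top"
        using eventually_ge_at_top[of 1]
      proof eventually_elim
        case (elim x)
        then have "e \<theta> x = (logint f (ln x + ln \<theta>) - logint f (ln x)) / ln \<theta>"
          using e[of "ln x" "ln \<theta>"] \<theta> by simp
        then show ?case using elim \<theta> by (simp add: pos_divide_le_eq)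
      qed
      then show "Q \<theta> \<le> ereal m" unfolding Q_def by (rule Limsup_bounded)
    qed
  qed
  have "(Q \<longlongrightarrow> ereal ?M) at_top"
  proof (rule order_tendstoI)
    fix a assume a: "a < ereal ?M"
    show "eventually (\<lambda>\<theta>. a < Q \<theta>) at_top"
      using eventually_gt_at_top[of 1] by eventually_elim (rule order_less_le_trans[OF a lower])
  next
    fix a assume "ereal ?M < a"
    then obtain m where m: "?M < m" "ereal m < a" using ereal_dense2[of "ereal ?M" a] by auto
    show "eventually (\<lambda>\<theta>. Q \<theta> < a) at_top"
      using upper[OF m(1)] by eventually_elim (use m(2) in auto)
  qed
  then have "Lim at_top Q = ereal ?M" by (rule tendsto_Lim[rotated]) simp
  then show ?thesis unfolding upper_mean_def Q_def e_def .
qed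

section \<open>The functionals in \<open>P_set\<close> and their domination by the upper
  mean\<close>

text \<open>If U contained some {x. x < c}, it would contain a bounded part of the half line. As a
  filter inequality the condition lets every statement valid for large T pass to U.\<close>

lemma ultrafilter_le_at_top_iff:
  fixes U :: "real filter"
  assumes U: "ultrafilter U"
  shows "U \<le> at_top \<longleftrightarrow> eventually (\<lambda>x. x \<ge> 0) U \<and> (\<forall>A. eventually (\<lambda>x. x \<in> A) U \<longrightarrow> \<not> bounded A)"
proof (intro iffI conjI allI impI notI)
  assume le: "U \<le> at_top"
  show "eventually (\<lambda>x. x \<ge> 0) U" using le eventually_ge_at_top filter_leD by blast
  fix A :: "real set" assume A: "eventually (\<lambda>x. x \<in> A) U" "bounded A"
  then obtain B where B: "\<And>x. x \<in> A \<Longrightarrow> \<bar>x\<bar> \<le> B" unfolding bounded_iff by auto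
  have "eventually (\<lambda>x. x > B) U" using le eventually_gt_at_top filter_leD by blast
  with A(1) have "eventually (\<lambda>_. False) U" by eventually_elim (use B in fastforce)
  then show False using ultrafilter_not_bot[OF U] by (simp add: trivial_limit_def)
next
  assume R: "eventually (\<lambda>x. x \<ge> 0) U \<and> (\<forall>A. eventually (\<lambda>x. x \<in> A) U \<longrightarrow> \<not> bounded A)"
  have "eventually (\<lambda>x. x \<ge> c) U" for c
  proof (rule ultrafilter_cases[OF U, of "\<lambda>x. x \<ge> c"])
    assume "eventually (\<lambda>x. \<not> x \<ge> c) U"
    with R have "eventually (\<lambda>x. x \<in> {0..c}) U" by (auto elim: eventually_elim2)
    then show ?thesis using R bounded_closed_interval by blast
  qed
  then have "filterlim (\<lambda>x. x) at_top U" unfolding filterlim_at_top by blast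
  then show "U \<le> at_top" by (simp add: filterlim_def filtermap_ident)
qed

lemma P_set_iff:
  "\<psi> \<in> P_set \<longleftrightarrow> (\<exists>U \<eta> s. Omega_star_pt \<eta> s \<and> ultrafilter U \<and> U \<le> at_top \<and> (\<forall>f\<in>Linf. \<psi> f = psi_UO U \<eta> s f))"
  by (simp add: P_set_def ultrafilter_le_at_top_iff cong: conj_cong)

text \<open>A non-principal ultrafilter excludes each single integer, hence by induction each
  initial segment.\<close>

lemma Omega_star_pt_tendsto:
  assumes "Omega_star_pt \<eta> s"
  shows "filterlim (\<lambda>n. real n + s) at_top \<eta>"
proof -
  have ne: "eventually (\<lambda>m. m \<noteq> n) \<eta>" for n
    using assms unfolding Omega_star_pt_def by (metis ultrafilter_cases)
  have "eventually (\<lambda>m. m \<ge> N) \<eta>" for N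
  proof (induction N)
    case (Suc N)
    then show ?case using ne[of N] by eventually_elim auto
  qed simp
  then have "filterlim (\<lambda>m. m) at_top \<eta>" unfolding filterlim_at_top by blast
  then have "\<eta> \<le> sequentially" by (simp add: filterlim_def filtermap_ident)
  moreover have "filterlim (\<lambda>n. real n + s) at_top sequentially"
    using filterlim_tendsto_add_at_top[OF tendsto_const filterlim_real_sequentially, of s]
    by (simp add: add.commute)
  ultimately show ?thesis using filterlim_mono by blast
qed

text \<open>In the variable T = ln x the means stay in [-C, C], a bound inherited from the
  increments of \<open>logint f\<close> through the limit along \<eta>. So the \<open>Lim\<close> in
  \<open>psi_UO\<close> is a genuine limit.\<close>

lemma psi_UO_tendsto:
  assumes f: "f \<in> Linf" and \<eta>: "Omega_star_pt \<eta> s" and U: "ultrafilter U" "U \<le> at_top"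
  shows "((\<lambda>T. (LINT t:{1..exp T}|lborel. mult_limit f \<eta> s t / t) / T) \<longlongrightarrow> psi_UO U \<eta> s f) U"
proof -
  let ?G = "\<lambda>T. LINT t:{1..exp T}|lborel. mult_limit f \<eta> s t / t"
  obtain C where "AE t in lborel. t \<ge> 1 \<longrightarrow> \<bar>f t\<bar> \<le> C" by (rule Linf_bound[OF f])
  note lip = logint_lipschitz[OF f this]
  have s: "s \<ge> 0" and bot: "\<eta> \<noteq> bot" using \<eta> ultrafilter_not_bot unfolding Omega_star_pt_def by auto
  have "\<bar>?G T / T\<bar> \<le> C" if T: "T > 0" for T
  proof -
    have "\<bar>?G T\<bar> \<le> C * T"
      by (rule tendsto_upperbound[OF tendsto_rabs[OF logint_increment_tendsto_mult_limit[OF f \<eta>]] always_eventually bot])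
        (use T s lip in auto)
    then show ?thesis using T by (simp add: abs_divide pos_divide_le_eq)
  qed
  moreover have "eventually (\<lambda>T. T > 0) U" using U(2) eventually_gt_at_top filter_leD by blast
  ultimately have "eventually (\<lambda>T. \<bar>?G T / T\<bar> \<le> C) U" by (auto elim: eventually_mono)
  then obtain l where l: "((\<lambda>T. ?G T / T) \<longlongrightarrow> l) U" by (rule ultrafilter_bounded_tendsto[OF U(1)])
  then have "((\<lambda>x. 1 / ln x * (LINT t:{1..x}|lborel. mult_limit f \<eta> s t / t)) \<longlongrightarrow> l) (filtermap exp U)"
    by (simp add: filterlim_filtermap)
  then have "psi_UO U \<eta> s f = l"
    unfolding psi_UO_def using ultrafilter_not_bot[OF ultrafilter_filtermap[OF U(1)]] tendsto_Lim by blast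
  then show ?thesis using l by simp
qed

text \<open>Weak inequalities survive both limits. This bound and the reverse one reduce estimates
  of \<open>psi_UO\<close> to increments of \<open>logint f\<close>, for large T and then
  \<eta>-almost all n.\<close>

lemma psi_UO_le:
  assumes f: "f \<in> Linf" and \<eta>: "Omega_star_pt \<eta> s" and U: "ultrafilter U" "U \<le> at_top"
    and m: "eventually (\<lambda>T. eventually (\<lambda>n. logint f (real n + s + T) - logint f (real n + s) \<le> m * T) \<eta>) at_top"
  shows "psi_UO U \<eta> s f \<le> m"
proof (rule tendsto_upperbound[OF psi_UO_tendsto[OF f \<eta> U] _ ultrafilter_not_bot[OF U(1)]])
  have bot: "\<eta> \<noteq> bot" using \<eta> ultrafilter_not_bot unfolding Omega_star_pt_def by auto
  show "eventually (\<lambda>T. (LINT t:{1..exp T}|lborel. mult_limit f \<eta> s t / t) / T \<le> m) U"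
    using filter_leD[OF U(2) m] filter_leD[OF U(2) eventually_gt_at_top[of 0]]
  proof eventually_elim
    case (elim T)
    have "(LINT t:{1..exp T}|lborel. mult_limit f \<eta> s t / t) \<le> m * T"
      by (rule tendsto_upperbound[OF logint_increment_tendsto_mult_limit[OF f \<eta>] _ bot]) (use elim in auto)
    then show ?case using elim by (simp add: pos_divide_le_eq)
  qed
qed

lemma psi_UO_ge:
  assumes f: "f \<in> Linf" and \<eta>: "Omega_star_pt \<eta> s" and U: "ultrafilter U" "U \<le> at_top"
    and m: "eventually (\<lambda>T. eventually (\<lambda>n. m * T \<le> logint f (real n + s + T) - logint f (real n + s)) \<eta>) at_top"
  shows "m \<le> psi_UO U \<eta> s f"
proof (rule tendsto_lowerbound[OF psi_UO_tendsto[OF f \<eta> U] _ ultrafilter_not_bot[OF U(1)]])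
  have bot: "\<eta> \<noteq> bot" using \<eta> ultrafilter_not_bot unfolding Omega_star_pt_def by auto
  show "eventually (\<lambda>T. m \<le> (LINT t:{1..exp T}|lborel. mult_limit f \<eta> s t / t) / T) U"
    using filter_leD[OF U(2) m] filter_leD[OF U(2) eventually_gt_at_top[of 0]]
  proof eventually_elim
    case (elim T)
    have "m * T \<le> (LINT t:{1..exp T}|lborel. mult_limit f \<eta> s t / t)"
      by (rule tendsto_lowerbound[OF logint_increment_tendsto_mult_limit[OF f \<eta>] _ bot]) (use elim in auto)
    then show ?case using elim by (simp add: pos_le_divide_eq)
  qed
qed

text \<open>The three values of \<open>mult_limit\<close> are chosen independently, so linearity is
  established for their integrals, as limits of increments along the same \<eta>.\<close>

lemma psi_UO_lincomb:
  assumes f: "f \<in> Linf" and g: "g \<in> Linf" and \<eta>: "Omega_star_pt \<eta> s" and U: "ultrafilter U" "U \<le> at_top"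
  shows "psi_UO U \<eta> s (\<lambda>t. a * f t + b * g t) = a * psi_UO U \<eta> s f + b * psi_UO U \<eta> s g"
proof -
  let ?h = "\<lambda>t. a * f t + b * g t"
  note fg = Linf_lincomb[OF f g, of a b]
  let ?G = "\<lambda>f T. LINT t:{1..exp T}|lborel. mult_limit f \<eta> s t / t"
  have s: "s \<ge> 0" and bot: "\<eta> \<noteq> bot" using \<eta> ultrafilter_not_bot unfolding Omega_star_pt_def by auto
  have G: "?G ?h T = a * ?G f T + b * ?G g T" if T: "T \<ge> 0" for T
  proof (rule tendsto_unique[OF bot logint_increment_tendsto_mult_limit[OF fg \<eta> T]])
    have eq: "logint ?h (real n + s + T) - logint ?h (real n + s)
      = a * (logint f (real n + s + T) - logint f (real n + s)) + b * (logint g (real n + s + T) - logint g (real n + s))" for n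
      using logint_lincomb[OF f g, of _ a b] s T by (simp add: algebra_simps)
    show "((\<lambda>n. logint ?h (real n + s + T) - logint ?h (real n + s)) \<longlongrightarrow> a * ?G f T + b * ?G g T) \<eta>"
      unfolding eq by (intro tendsto_intros logint_increment_tendsto_mult_limit f g \<eta> T)
  qed
  have "((\<lambda>T. ?G ?h T / T) \<longlongrightarrow> a * psi_UO U \<eta> s f + b * psi_UO U \<eta> s g) U"
  proof (rule Lim_transform_eventually)
    show "((\<lambda>T. a * (?G f T / T) + b * (?G g T / T)) \<longlongrightarrow> a * psi_UO U \<eta> s f + b * psi_UO U \<eta> s g) U"
      by (intro tendsto_intros psi_UO_tendsto f g \<eta> U)
    show "eventually (\<lambda>T. a * (?G f T / T) + b * (?G g T / T) = ?G ?h T / T) U"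
      using filter_leD[OF U(2) eventually_ge_at_top[of 0]]
      by eventually_elim (simp add: G add_divide_distrib)
  qed
  then show ?thesis using tendsto_unique[OF ultrafilter_not_bot[OF U(1)] psi_UO_tendsto[OF fg \<eta> U]] by blast
qed

lemma P_set_subset_L1_set: "P_set \<subseteq> L1_set"
proof
  fix \<psi> assume "\<psi> \<in> P_set"
  then obtain U \<eta> s where \<eta>: "Omega_star_pt \<eta> s" and U: "ultrafilter U" "U \<le> at_top"
    and \<psi>: "\<And>f. f \<in> Linf \<Longrightarrow> \<psi> f = psi_UO U \<eta> s f"
    unfolding P_set_iff by blast
  have s: "s \<ge> 0" using \<eta> unfolding Omega_star_pt_def by simp
  have ev: "eventually P at_top" if "\<And>T::real. T \<ge> 0 \<Longrightarrow> P T" for P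
    using eventually_ge_at_top[of 0] by eventually_elim (rule that)
  have "\<psi> (\<lambda>t. a * f t + b * g t) = a * \<psi> f + b * \<psi> g" if "f \<in> Linf" "g \<in> Linf" for f g a b
    using psi_UO_lincomb[OF that \<eta> U] \<psi> Linf_lincomb[OF that] that by simp
  moreover have "\<psi> f \<ge> 0" if f: "f \<in> Linf" "AE t in lborel. t \<ge> 1 \<longrightarrow> f t \<ge> 0" for f
    unfolding \<psi>[OF f(1)]
    by (rule psi_UO_ge[OF f(1) \<eta> U ev]) (use logint_mono[OF f] s in auto)
  moreover have "\<psi> (\<lambda>_. 1) = 1"
    unfolding \<psi>[OF Linf_const]
  proof (rule antisym)
    show "psi_UO U \<eta> s (\<lambda>_. 1) \<le> 1"
      by (rule psi_UO_le[OF Linf_const \<eta> U ev]) (use s in \<open>simp add: logint_one\<close>)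
    show "1 \<le> psi_UO U \<eta> s (\<lambda>_. 1)"
      by (rule psi_UO_ge[OF Linf_const \<eta> U ev]) (use s in \<open>simp add: logint_one\<close>)
  qed
  moreover have "ereal (\<psi> f) \<le> upper_mean f" if f: "f \<in> Linf" for f
  proof -
    obtain C where C: "AE t in lborel. t \<ge> 1 \<longrightarrow> \<bar>f t\<bar> \<le> C" by (rule Linf_bound[OF f])
    have "\<psi> f \<le> upper_slope (logint f)"
    \<comment> \<open>The infimum \<open>upper_slope\<close> need not be attained by any length, so
      the estimate is available only for m strictly above it.\<close>
    proof (rule dense_ge)
      fix m assume m: "upper_slope (logint f) < m"
      have "eventually (\<lambda>T. eventually (\<lambda>u. logint f (u + T) - logint f u \<le> m * T) at_top) at_top"
        by (rule eventually_increment_le[OF _ m]) (rule logint_lipschitz[OF f C])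
      then have "eventually (\<lambda>T. eventually (\<lambda>n. logint f (real n + s + T) - logint f (real n + s) \<le> m * T) \<eta>) at_top"
        by (rule eventually_mono) (rule eventually_compose_filterlim[OF _ Omega_star_pt_tendsto[OF \<eta>]])
      then show "\<psi> f \<le> m" unfolding \<psi>[OF f] by (rule psi_UO_le[OF f \<eta> U])
    qed
    then show ?thesis using upper_mean_eq[OF f] by simp
  qed
  ultimately show "\<psi> \<in> L1_set" unfolding L1_set_def by blast
qed

section \<open>Attainment of the upper mean\<close>

lemma P_set_attains_upper_mean:
  assumes f: "f \<in> Linf"
  obtains \<phi> where "\<phi> \<in> P_set" "upper_mean f \<le> ereal (\<phi> f)"
proof -
  let ?H = "logint f"
  define M where "M = upper_slope ?H"
  obtain C where C: "C \<ge> 0" "AE t in lborel. t \<ge> 1 \<longrightarrow> \<bar>f t\<bar> \<le> C" by (rule Linf_bound[OF f])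
  note lip = logint_lipschitz[OF f C(2)]
  have dist: "\<bar>?H x - ?H y\<bar> \<le> C * \<bar>x - y\<bar>" if "0 \<le> x" "0 \<le> y" for x y
    using lip[of x "y - x"] lip[of y "x - y"] that by (cases "x \<le> y") (auto simp: abs_minus_commute)
  \<comment> \<open>A diagonal choice: the k-th start lies beyond k, is steep on all lengths up to
    k, and loses only 1 / (k + 1) in slope. Any fixed T is covered by all large k with vanishing
    loss.\<close>
  have "\<exists>u. u \<ge> real k \<and> u \<ge> 0 \<and> (\<forall>t. 0 \<le> t \<longrightarrow> t \<le> real k \<longrightarrow> (M - 1 / real (Suc k)) * t \<le> ?H (u + t) - ?H u)" for k
    unfolding M_def by (rule steep_start_exists[of ?H C "1 / real (Suc k)" "real k" "real k", OF lip]) auto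
  then obtain u where u: "\<And>k. u k \<ge> real k" "\<And>k. u k \<ge> 0"
    "\<And>k t. 0 \<le> t \<Longrightarrow> t \<le> real k \<Longrightarrow> (M - 1 / real (Suc k)) * t \<le> ?H (u k + t) - ?H (u k)"
    by metis
  \<comment> \<open>A point of Omega* has integers and one common shift, while the starts are
    arbitrary reals. The integer parts push W forward to \<eta>, and the fractional parts are
    replaced by their limit \<open>s\<close> along W. That limit may equal 1 although each \<sigma>
    k is below 1.\<close>
  define n where "n k = nat \<lfloor>u k\<rfloor>" for k
  define \<sigma> where "\<sigma> k = u k - real (n k)" for k
  have n: "real (n k) = of_int \<lfloor>u k\<rfloor>" for k unfolding n_def using u(2)[of k] by simp
  have \<sigma>: "0 \<le> \<sigma> k" "\<sigma> k \<le> 1" for k unfolding \<sigma>_def n by linarith+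
  obtain W :: "nat filter" where W: "W \<le> sequentially" "ultrafilter W"
    using ultrafilter_refinement_exists[of sequentially] by auto
  note W_bot = ultrafilter_not_bot[OF W(2)]
  have "eventually (\<lambda>k. \<bar>\<sigma> k\<bar> \<le> 1) W" using \<sigma> by (intro always_eventually) auto
  then obtain s where s: "(\<sigma> \<longlongrightarrow> s) W" "\<bar>s\<bar> \<le> 1" by (rule ultrafilter_bounded_tendsto[OF W(2)])
  have s0: "0 \<le> s" by (rule tendsto_lowerbound[OF s(1) _ W_bot]) (use \<sigma> in auto)
  define \<eta> where "\<eta> = filtermap n W"
  have "\<not> eventually (\<lambda>m. m = j) \<eta>" for j
  proof
    assume "eventually (\<lambda>m. m = j) \<eta>"
    then have "eventually (\<lambda>k. n k = j) W" unfolding \<eta>_def by (simp add: eventually_filtermap)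
    moreover have "eventually (\<lambda>k. k > j + 1) W" by (rule filter_leD[OF W(1) eventually_gt_at_top])
    ultimately have "eventually (\<lambda>_. False) W"
    proof eventually_elim
      case (elim k)
      have "u k < real (n k) + 1" unfolding n by linarith
      then show False using u(1)[of k] elim by simp
    qed
    then show False using W_bot by (simp add: trivial_limit_def)
  qed
  then have \<eta>: "Omega_star_pt \<eta> s"
    unfolding Omega_star_pt_def using s s0 ultrafilter_filtermap[OF W(2)] by (simp add: \<eta>_def)
  obtain U :: "real filter" where U: "U \<le> at_top" "ultrafilter U"
    using ultrafilter_refinement_exists[of "at_top :: real filter"] by auto
  have "M \<le> psi_UO U \<eta> s f"
  proof (rule field_le_epsilon)
    fix \<epsilon> :: real assume eps: "\<epsilon> > 0"
    have "M - \<epsilon> \<le> psi_UO U \<eta> s f"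
    proof (rule psi_UO_ge[OF f \<eta> U(2,1)])
      show "eventually (\<lambda>T. eventually (\<lambda>n. (M - \<epsilon>) * T \<le> ?H (real n + s + T) - ?H (real n + s)) \<eta>) at_top"
        using eventually_gt_at_top[of 0]
      proof eventually_elim
        case (elim T)
        \<comment> \<open>Half of \<epsilon> pays for moving both endpoints from \<open>u k\<close>
          to \<open>real (n k) + s\<close>, each at cost C * \<bar>s - \<sigma> k\<bar>; the other
          half pays for the slope loss 1 / (k + 1).\<close>
        have "((\<lambda>k. 2 * (C * \<bar>s - \<sigma> k\<bar>)) \<longlongrightarrow> 2 * (C * \<bar>s - s\<bar>)) W" by (intro tendsto_intros s)
        then have "eventually (\<lambda>k. 2 * (C * \<bar>s - \<sigma> k\<bar>) < \<epsilon> / 2 * T) W"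
          using eps elim by (intro order_tendstoD) auto
        moreover have "eventually (\<lambda>k. 1 / real (Suc k) < \<epsilon> / 2) W"
          using eps by (intro filter_leD[OF W(1)] order_tendstoD[OF LIMSEQ_Suc[OF lim_1_over_n]]) simp
        moreover have "eventually (\<lambda>k. real k \<ge> T) W"
          using filter_leD[OF W(1)] eventually_ge_at_top filterlim_real_sequentially
          unfolding filterlim_at_top by blast
        ultimately have "eventually (\<lambda>k. (M - \<epsilon>) * T \<le> ?H (real (n k) + s + T) - ?H (real (n k) + s)) W"
        proof eventually_elim
          case (elim k)
          have "1 / real (Suc k) * T \<le> \<epsilon> / 2 * T"
            using elim(2) \<open>0 < T\<close> by (intro mult_right_mono) auto
          moreover have "(M - 1 / real (Suc k)) * T \<le> ?H (u k + T) - ?H (u k)"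
            using u(3) elim(3) \<open>0 < T\<close> by simp
          moreover have "\<bar>?H (real (n k) + s + T) - ?H (u k + T)\<bar> \<le> C * \<bar>s - \<sigma> k\<bar>"
            "\<bar>?H (real (n k) + s) - ?H (u k)\<bar> \<le> C * \<bar>s - \<sigma> k\<bar>"
            using dist[of "real (n k) + s + T" "u k + T"] dist[of "real (n k) + s" "u k"] s0 u(2)[of k] \<open>0 < T\<close>
            by (simp_all add: \<sigma>_def algebra_simps)
          ultimately show ?case using elim(1) by (simp only: left_diff_distrib)
        qed
        then show ?case unfolding \<eta>_def by (simp add: eventually_filtermap)
      qed
    qed
    then show "M \<le> psi_UO U \<eta> s f + \<epsilon>" by simp
  qed
  moreover have "psi_UO U \<eta> s \<in> P_set" unfolding P_set_iff using \<eta> U by blast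
  ultimately show thesis using that upper_mean_eq[OF f] unfolding M_def by simp
qed

section \<open>Weak* density of the convex hull\<close>

lemma L1_setD:
  assumes "\<psi> \<in> L1_set"
  shows "f \<in> Linf \<Longrightarrow> g \<in> Linf \<Longrightarrow> \<psi> (\<lambda>t. a * f t + b * g t) = a * \<psi> f + b * \<psi> g"
    and "f \<in> Linf \<Longrightarrow> (AE t in lborel. t \<ge> 1 \<longrightarrow> f t \<ge> 0) \<Longrightarrow> \<psi> f \<ge> 0"
    and "\<psi> (\<lambda>_. 1) = 1"
    and "f \<in> Linf \<Longrightarrow> ereal (\<psi> f) \<le> upper_mean f"
  using assms unfolding L1_set_def by blast+

text \<open>Positivity applied to C + f and C - f. The bound is uniform over \<open>L1_set\<close>,
  so each step of the greedy average below has bounded size in every coordinate.\<close>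

lemma L1_set_abs_le:
  assumes \<psi>: "\<psi> \<in> L1_set" and f: "f \<in> Linf" and C: "AE t in lborel. t \<ge> 1 \<longrightarrow> \<bar>f t\<bar> \<le> C"
  shows "\<bar>\<psi> f\<bar> \<le> C"
proof -
  have nn: "0 \<le> \<psi> (\<lambda>t. C * 1 + b * f t)" if b: "\<bar>b\<bar> = 1" for b
  proof (rule L1_setD(2)[OF \<psi> Linf_lincomb[OF Linf_const f]])
    show "AE t in lborel. t \<ge> 1 \<longrightarrow> 0 \<le> C * 1 + b * f t"
      using C
    proof eventually_elim
      case (elim t)
      have "\<bar>b * f t\<bar> = \<bar>f t\<bar>" using b by (simp add: abs_mult)
      then show ?case using elim by linarith
    qed
  qed
  have "\<psi> (\<lambda>t. C * 1 + b * f t) = C + b * \<psi> f" for b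
    using L1_setD(1)[OF \<psi> Linf_const f, of C 1 b] L1_setD(3)[OF \<psi>] by simp
  then show ?thesis using nn[of 1] nn[of "-1"] by (simp only: abs_le_iff) simp
qed

lemma Linf_sum:
  assumes "finite F" "F \<subseteq> Linf"
  shows "(\<lambda>t. \<Sum>f\<in>F. c f * f t) \<in> Linf"
  using assms
proof (induction F rule: finite_induct)
  case empty
  then show ?case using Linf_const[of 0] by simp
next
  case (insert f F)
  then show ?case using Linf_lincomb[of f "\<lambda>t. \<Sum>f\<in>F. c f * f t" "c f" 1] by simp
qed

lemma L1_set_sum:
  assumes \<psi>: "\<psi> \<in> L1_set" and "finite F" "F \<subseteq> Linf"
  shows "\<psi> (\<lambda>t. \<Sum>f\<in>F. c f * f t) = (\<Sum>f\<in>F. c f * \<psi> f)"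
  using assms(2,3)
proof (induction F rule: finite_induct)
  case empty
  have "\<psi> (\<lambda>_. 0) = 0" using L1_setD(1)[OF \<psi> Linf_const Linf_const, of 0 0 0 0] by simp
  then show ?case by simp
next
  case (insert f F)
  then show ?case
    using L1_setD(1)[OF \<psi> _ Linf_sum[of F c], of f "c f" 1] by simp
qed

text \<open>A greedy average in place of Hahn--Banach separation: each new point of \<open>P_set\<close> is chosen
  on the far side of \<open>\<psi>\<close>, so that the squared deviations of the partial sums grow only linearly.\<close>

lemma greedy_approximation:
  assumes \<psi>: "\<psi> \<in> L1_set" and F: "finite F" "F \<subseteq> Linf"
    and C: "\<And>\<phi> f. \<phi> \<in> L1_set \<Longrightarrow> f \<in> F \<Longrightarrow> \<bar>\<phi> f\<bar> \<le> C f"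
  shows "\<exists>\<phi>. (\<forall>i<N. \<phi> i \<in> P_set) \<and>
    (\<Sum>f\<in>F. (\<Sum>i<N. \<phi> i f - \<psi> f)\<^sup>2) \<le> real N * (\<Sum>f\<in>F. (2 * C f)\<^sup>2)"
proof (induction N)
  case (Suc N)
  then obtain \<phi> where \<phi>: "\<forall>i<N. \<phi> i \<in> P_set"
    "(\<Sum>f\<in>F. (\<Sum>i<N. \<phi> i f - \<psi> f)\<^sup>2) \<le> real N * (\<Sum>f\<in>F. (2 * C f)\<^sup>2)" by blast
  define a where "a f = (\<Sum>i<N. \<phi> i f - \<psi> f)" for f
  \<comment> \<open>Attainment of the upper mean at \<open>g\<close> yields \<xi> with \<psi> g
    \<le> \<xi> g. As \<open>g\<close> has coefficients -a f, the new deviation \<xi> - \<psi> then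
    has nonpositive inner product with the accumulated deviation \<open>a\<close>, and the cross
    term in the square drops out.\<close>
  define g where "g t = (\<Sum>f\<in>F. - a f * f t)" for t
  have g: "g \<in> Linf" unfolding g_def using F by (rule Linf_sum)
  have lin: "\<xi> g = - (\<Sum>f\<in>F. a f * \<xi> f)" if "\<xi> \<in> L1_set" for \<xi>
    unfolding g_def using L1_set_sum[OF that F, of "\<lambda>f. - a f"] by (simp add: sum_negf)
  obtain \<xi> where \<xi>: "\<xi> \<in> P_set" "upper_mean g \<le> ereal (\<xi> g)"
    by (rule P_set_attains_upper_mean[OF g])
  have \<xi>1: "\<xi> \<in> L1_set" using \<xi>(1) P_set_subset_L1_set by blast
  have "ereal (\<psi> g) \<le> ereal (\<xi> g)" using L1_setD(4)[OF \<psi> g] \<xi>(2) by (rule order_trans)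
  then have "(\<Sum>f\<in>F. a f * \<xi> f) \<le> (\<Sum>f\<in>F. a f * \<psi> f)" using lin[OF \<psi>] lin[OF \<xi>1] by simp
  then have cross: "(\<Sum>f\<in>F. a f * (\<xi> f - \<psi> f)) \<le> 0" by (simp add: right_diff_distrib sum_subtractf)
  have sq: "(\<Sum>f\<in>F. (\<xi> f - \<psi> f)\<^sup>2) \<le> (\<Sum>f\<in>F. (2 * C f)\<^sup>2)"
  proof (rule sum_mono)
    fix f assume "f \<in> F"
    then have "\<bar>\<xi> f - \<psi> f\<bar> \<le> 2 * C f" using C[OF \<xi>1, of f] C[OF \<psi>, of f] by linarith
    then show "(\<xi> f - \<psi> f)\<^sup>2 \<le> (2 * C f)\<^sup>2" using power_mono[of "\<bar>\<xi> f - \<psi> f\<bar>" "2 * C f" 2] by simp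
  qed
  let ?\<phi> = "\<phi>(N := \<xi>)"
  have "(\<Sum>i<Suc N. ?\<phi> i f - \<psi> f) = a f + (\<xi> f - \<psi> f)" for f
    unfolding a_def by simp
  then have "(\<Sum>f\<in>F. (\<Sum>i<Suc N. ?\<phi> i f - \<psi> f)\<^sup>2) = (\<Sum>f\<in>F. (a f + (\<xi> f - \<psi> f))\<^sup>2)"
    by simp
  also have "\<dots> = (\<Sum>f\<in>F. (a f)\<^sup>2) + 2 * (\<Sum>f\<in>F. a f * (\<xi> f - \<psi> f)) + (\<Sum>f\<in>F. (\<xi> f - \<psi> f)\<^sup>2)"
    unfolding power2_sum sum.distrib sum_distrib_left by (simp add: mult.assoc)
  also have "\<dots> \<le> real (Suc N) * (\<Sum>f\<in>F. (2 * C f)\<^sup>2)"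
    using \<phi>(2) cross sq unfolding a_def[symmetric] by (simp add: distrib_right)
  finally show ?case using \<phi>(1) \<xi>(1) by (intro exI[of _ ?\<phi>]) (auto simp: less_Suc_eq)
qed auto

lemma L1_set_subset_closure: "L1_set \<subseteq> wstar_closure (conv_fun P_set)"
proof
  fix \<psi> assume \<psi>: "\<psi> \<in> L1_set"
  have "\<exists>\<phi>\<in>conv_fun P_set. \<forall>f\<in>F. \<bar>\<psi> f - \<phi> f\<bar> < \<epsilon>" if F: "finite F" "F \<subseteq> Linf" and eps: "\<epsilon> > 0" for F and \<epsilon> :: real
  proof -
    have "\<exists>C. \<forall>\<phi>\<in>L1_set. \<bar>\<phi> f\<bar> \<le> C" if "f \<in> F" for f
      using that F(2) L1_set_abs_le Linf_bound by (metis subsetD)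
    then obtain C where C: "\<And>f \<phi>. f \<in> F \<Longrightarrow> \<phi> \<in> L1_set \<Longrightarrow> \<bar>\<phi> f\<bar> \<le> C f" by metis
    define B where "B = (\<Sum>f\<in>F. (2 * C f)\<^sup>2)"
    \<comment> \<open>After division by N the squared deviation is at most B / N, which must fall
      below the square of \<epsilon>; the successor keeps N positive.\<close>
    obtain N0 :: nat where "B / \<epsilon>\<^sup>2 < real N0" using reals_Archimedean2 by blast
    define N where "N = Suc N0"
    have N: "N > 0" "B < real N * \<epsilon>\<^sup>2"
      using \<open>B / \<epsilon>\<^sup>2 < real N0\<close> eps unfolding N_def by (auto simp: field_simps add_pos_pos intro: less_trans)
    obtain \<phi> where \<phi>: "\<forall>i<N. \<phi> i \<in> P_set" "(\<Sum>f\<in>F. (\<Sum>i<N. \<phi> i f - \<psi> f)\<^sup>2) \<le> real N * B"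
      using greedy_approximation[of \<psi> F C N] \<psi> F C unfolding B_def by blast
    define \<xi> where "\<xi> = (\<lambda>f. \<Sum>i<N. 1 / real N * \<phi> i f)"
    have "\<xi> \<in> conv_fun P_set"
      unfolding conv_fun_def \<xi>_def using N(1) \<phi>(1)
      by (auto intro!: exI[of _ N] exI[of _ "\<lambda>_. 1 / real N"] exI[of _ \<phi>])
    moreover have "\<bar>\<psi> f - \<xi> f\<bar> < \<epsilon>" if f: "f \<in> F" for f
    proof -
      let ?d = "\<Sum>i<N. \<phi> i f - \<psi> f"
      have "\<xi> f = (\<Sum>i<N. \<phi> i f) / real N" unfolding \<xi>_def by (simp add: sum_divide_distrib)
      then have d: "\<xi> f - \<psi> f = ?d / real N" using N(1) by (simp add: sum_subtractf field_simps)
      have "?d\<^sup>2 \<le> (\<Sum>f\<in>F. (\<Sum>i<N. \<phi> i f - \<psi> f)\<^sup>2)"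
        by (rule member_le_sum[OF f, of "\<lambda>f. (\<Sum>i<N. \<phi> i f - \<psi> f)\<^sup>2"]) (use F in auto)
      also have "\<dots> \<le> real N * B" by (rule \<phi>(2))
      also have "\<dots> < real N * (real N * \<epsilon>\<^sup>2)" using N by simp
      also have "\<dots> = (real N * \<epsilon>)\<^sup>2" by (simp add: power2_eq_square)
      finally have "\<bar>?d\<bar> < real N * \<epsilon>" using power2_less_imp_less[of "\<bar>?d\<bar>" "real N * \<epsilon>"] eps by simp
      then show ?thesis
        using d N(1) by (simp add: abs_minus_commute[of "\<psi> f"] abs_divide pos_divide_less_eq mult.commute)
    qed
    ultimately show ?thesis by blast
  qed
  then show "\<psi> \<in> wstar_closure (conv_fun P_set)" unfolding wstar_closure_def by blast
qed

section \<open>Convexity and weak* closedness of \<open>L1_set\<close>\<close>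

lemma conv_fun_L1_set: "conv_fun L1_set \<subseteq> L1_set"
proof
  fix \<psi> assume "\<psi> \<in> conv_fun L1_set"
  then obtain n :: nat and c \<phi> where c: "\<And>i. i < n \<Longrightarrow> c i \<ge> (0::real)" and \<phi>: "\<And>i. i < n \<Longrightarrow> \<phi> i \<in> L1_set"
    and sum: "(\<Sum>i<n. c i) = 1" and \<psi>: "\<psi> = (\<lambda>f. \<Sum>i<n. c i * \<phi> i f)"
    unfolding conv_fun_def by blast
  have "\<psi> (\<lambda>t. a * f t + b * g t) = a * \<psi> f + b * \<psi> g" if "f \<in> Linf" "g \<in> Linf" for f g a b
    unfolding \<psi> sum_distrib_left sum.distrib[symmetric]
    by (rule sum.cong) (use L1_setD(1)[OF \<phi> that] in \<open>simp_all add: algebra_simps\<close>)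
  moreover have "\<psi> f \<ge> 0" if "f \<in> Linf" "AE t in lborel. t \<ge> 1 \<longrightarrow> f t \<ge> 0" for f
    unfolding \<psi> using c L1_setD(2)[OF \<phi> that] by (auto intro!: sum_nonneg)
  moreover have "\<psi> (\<lambda>_. 1) = 1" unfolding \<psi> using L1_setD(3)[OF \<phi>] sum by simp
  moreover have "ereal (\<psi> f) \<le> upper_mean f" if f: "f \<in> Linf" for f
  proof -
    \<comment> \<open>Replacing the extended real \<open>upper_mean f\<close> by the real
      \<open>upper_slope\<close> makes averaging with the weights \<open>c i\<close> ordinary real
      arithmetic.\<close>
    have "\<psi> f \<le> (\<Sum>i<n. c i * upper_slope (logint f))"
      unfolding \<psi> using c L1_setD(4)[OF \<phi> f] upper_mean_eq[OF f] by (intro sum_mono mult_left_mono) auto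
    then show ?thesis using sum upper_mean_eq[OF f] by (simp add: sum_distrib_right[symmetric])
  qed
  ultimately show "\<psi> \<in> L1_set" unfolding L1_set_def by blast
qed

text \<open>The weak* closure itself need not be sequential, but each condition defining
  \<open>L1_set\<close> involves at most three values of the functional, and on finitely many test
  functions a sequence suffices. The conditions then pass to limits of real sequences.\<close>

lemma wstar_closure_sequence:
  assumes "\<psi> \<in> wstar_closure S" "finite F" "F \<subseteq> Linf"
  obtains \<phi> :: "nat \<Rightarrow> _" where "\<And>n. \<phi> n \<in> S" "\<And>f. f \<in> F \<Longrightarrow> (\<lambda>n. \<phi> n f) \<longlonglongrightarrow> \<psi> f"
proof -
  have "\<exists>\<phi>\<in>S. \<forall>f\<in>F. \<bar>\<psi> f - \<phi> f\<bar> < 1 / real (Suc n)" for n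
    using assms unfolding wstar_closure_def by simp
  then obtain \<phi> where \<phi>: "\<And>n. \<phi> n \<in> S" "\<And>n f. f \<in> F \<Longrightarrow> \<bar>\<psi> f - \<phi> n f\<bar> < 1 / real (Suc n)" by metis
  have "(\<lambda>n. \<phi> n f) \<longlonglongrightarrow> \<psi> f" if f: "f \<in> F" for f
  proof -
    have "(\<lambda>n. \<phi> n f - \<psi> f) \<longlonglongrightarrow> 0"
      by (rule Lim_null_comparison[OF always_eventually LIMSEQ_Suc[OF lim_1_over_n]], rule allI)
        (use \<phi>(2)[OF f] in \<open>simp add: abs_minus_commute less_imp_le\<close>)
    then show ?thesis by (simp add: LIM_zero_iff)
  qed
  then show thesis using that \<phi>(1) by blast
qed

lemma wstar_closure_L1_set: "wstar_closure L1_set \<subseteq> L1_set"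
proof
  fix \<psi> assume \<psi>: "\<psi> \<in> wstar_closure L1_set"
  have "\<psi> (\<lambda>t. a * f t + b * g t) = a * \<psi> f + b * \<psi> g" if fg: "f \<in> Linf" "g \<in> Linf" for f g a b
  proof -
    let ?h = "\<lambda>t. a * f t + b * g t"
    obtain \<phi> where \<phi>: "\<And>n::nat. \<phi> n \<in> L1_set" "\<And>h. h \<in> {f, g, ?h} \<Longrightarrow> (\<lambda>n. \<phi> n h) \<longlonglongrightarrow> \<psi> h"
      by (rule wstar_closure_sequence[OF \<psi>, of "{f, g, ?h}"]) (use fg Linf_lincomb[OF fg] in auto)
    have "(\<lambda>n. a * \<phi> n f + b * \<phi> n g) \<longlonglongrightarrow> a * \<psi> f + b * \<psi> g"
      by (intro tendsto_intros \<phi>(2)) auto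
    moreover have "(\<lambda>n. \<phi> n ?h) \<longlonglongrightarrow> \<psi> ?h" by (rule \<phi>(2)) simp
    ultimately show ?thesis using L1_setD(1)[OF \<phi>(1) fg] LIMSEQ_unique by simp
  qed
  moreover have "\<psi> f \<ge> 0" if f: "f \<in> Linf" "AE t in lborel. t \<ge> 1 \<longrightarrow> f t \<ge> 0" for f
  proof -
    obtain \<phi> where \<phi>: "\<And>n::nat. \<phi> n \<in> L1_set" "\<And>h. h \<in> {f} \<Longrightarrow> (\<lambda>n. \<phi> n h) \<longlonglongrightarrow> \<psi> h"
      by (rule wstar_closure_sequence[OF \<psi>, of "{f}"]) (use f in auto)
    show ?thesis by (rule LIMSEQ_le_const[OF \<phi>(2)]) (use L1_setD(2)[OF \<phi>(1) f] in auto)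
  qed
  moreover have "\<psi> (\<lambda>_. 1) = 1"
  proof -
    obtain \<phi> where \<phi>: "\<And>n::nat. \<phi> n \<in> L1_set" "\<And>h. h \<in> {\<lambda>_. 1} \<Longrightarrow> (\<lambda>n. \<phi> n h) \<longlonglongrightarrow> \<psi> h"
      by (rule wstar_closure_sequence[OF \<psi>, of "{\<lambda>_. 1}"]) (use Linf_const in auto)
    then show ?thesis using L1_setD(3)[OF \<phi>(1)] LIMSEQ_unique[OF _ tendsto_const] by fastforce
  qed
  moreover have "ereal (\<psi> f) \<le> upper_mean f" if f: "f \<in> Linf" for f
  proof -
    obtain \<phi> where \<phi>: "\<And>n::nat. \<phi> n \<in> L1_set" "\<And>h. h \<in> {f} \<Longrightarrow> (\<lambda>n. \<phi> n h) \<longlonglongrightarrow> \<psi> h"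
      by (rule wstar_closure_sequence[OF \<psi>, of "{f}"]) (use f in auto)
    have "\<psi> f \<le> upper_slope (logint f)"
      by (rule LIMSEQ_le_const2[OF \<phi>(2)]) (use L1_setD(4)[OF \<phi>(1) f] upper_mean_eq[OF f] in auto)
    then show ?thesis using upper_mean_eq[OF f] by simp
  qed
  ultimately show "\<psi> \<in> L1_set" unfolding L1_set_def by blast
qed

theorem theorem4p9:
  shows "L1_set = wstar_closure (conv_fun P_set)"
proof (rule antisym[OF L1_set_subset_closure])
  have "conv_fun P_set \<subseteq> conv_fun L1_set"
    unfolding conv_fun_def using P_set_subset_L1_set by blast
  then have "conv_fun P_set \<subseteq> L1_set" using conv_fun_L1_set by blast
  then have "wstar_closure (conv_fun P_set) \<subseteq> wstar_closure L1_set"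
    unfolding wstar_closure_def by (fast intro: bexI)
  then show "wstar_closure (conv_fun P_set) \<subseteq> L1_set" using wstar_closure_L1_set by blast
qed

end
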